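(* Let $\Bbbk$ be a field. For every integer $n\ge3$ and every integer $1\le q\le\nu(\mathcal W_n)$, where $\mathcal W_n$ is the wheel graph on $\{x_1,\ldots,x_n,v\}$ and $R=\Bbbk[x_1,\ldots,x_n,v]$, \[ \operatorname{depth}\big(R/I(\mathcal W_n)^{[q]}\big)=2q-1 . \]
   Context: For $n\ge3$, the wheel graph $\mathcal W_n$ has vertex set $\{x_1,\ldots,x_n,v\}$; the vertices $x_1,\ldots,x_n$ form a cycle of length $n$, and $v$ is adjacent to all of $x_1,\ldots,x_n$. $\nu(X)$ denotes the matching number of a graph $X$ (maximum number of pairwise vertex-disjoint edges). A $q$-matching of a graph is a set $M$ of $q$ pairwise vertex-disjoint edges, and $V(M)$ is the set of vertices it covers. For a graph $X$, the $q$-th squarefree power $I(X)^{[q]}$ is the ideal, in the polynomial ring over $\Bbbk$ whose variables are the vertices of $X$, generated by all monomials $\prod_{u\in V(M)}u$ with $M$ a $q$-matching of $X$. Depth is taken with respect to the homogeneous maximal ideal. *)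

theory Defs
  imports "HOL-Algebra.Module" "HOL-Algebra.QuotRing" "HOL-Library.Poly_Mapping"
    "HOL-Library.Extended_Nat"
begin

section \<open>Graphs and matchings\<close>

text \<open>A graph is given by its set of edges, each edge being a two-element set of vertices.\<close>

definition q_matching :: "'v set set \<Rightarrow> nat \<Rightarrow> 'v set set \<Rightarrow> bool" where
  "q_matching E q M \<longleftrightarrow> M \<subseteq> E \<and> finite M \<and> card M = q \<and> pairwise disjnt M"

text \<open>Meaningful for finite \<open>E\<close>; the empty matching makes the set below nonempty.\<close>

definition matching_number :: "'v set set \<Rightarrow> nat" where
  "matching_number E = Max {q. \<exists>M. q_matching E q M}"

text \<open>The rim vertices that occur in the wheel with rim length \<open>n\<close> are \<open>Rim 1, \<dots>, Rim n\<close>.\<close>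

datatype wheel_vertex = Rim nat | Hub

definition wheel_vertices :: "nat \<Rightarrow> wheel_vertex set" where
  "wheel_vertices n = insert Hub (Rim ` {1..n})"

definition wheel_edges :: "nat \<Rightarrow> wheel_vertex set set" where
  "wheel_edges n =
     {{Rim i, Rim (Suc i)} | i. 1 \<le> i \<and> i < n} \<union> {{Rim n, Rim 1}}
     \<union> {{Hub, Rim i} | i. 1 \<le> i \<and> i \<le> n}"


section \<open>Polynomial rings and squarefree powers of edge ideals\<close>

type_synonym ('v, 'k) mpoly = "('v \<Rightarrow>\<^sub>0 nat) \<Rightarrow>\<^sub>0 'k"

text \<open>The polynomial ring in the variables \<open>V\<close>: those polynomials over the type of all
  variables whose monomials involve only variables from \<open>V\<close>.\<close>

definition poly_ring :: "'v set \<Rightarrow> ('v, 'k::field) mpoly ring" where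
  "poly_ring V =
     \<lparr>carrier = {p. \<forall>m\<in>Poly_Mapping.keys p. Poly_Mapping.keys m \<subseteq> V},
      mult = (*), one = 1, zero = 0, add = (+)\<rparr>"

definition poly_var :: "'v \<Rightarrow> ('v, 'k::field) mpoly" where
  "poly_var x = Poly_Mapping.single (Poly_Mapping.single x 1) 1"

definition homogeneous_maximal_ideal :: "'v set \<Rightarrow> ('v, 'k::field) mpoly set" where
  "homogeneous_maximal_ideal V = genideal (poly_ring V) (poly_var ` V)"

text \<open>For a matching \<open>M\<close>, the set of vertices it covers is \<open>\<Union>M\<close>.\<close>

definition squarefree_power ::
    "'v set \<Rightarrow> 'v set set \<Rightarrow> nat \<Rightarrow> ('v, 'k::field) mpoly set" where
  "squarefree_power V E q =
     genideal (poly_ring V) {\<Prod>u\<in>\<Union>M. poly_var u | M. q_matching E q M}"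


section \<open>Depth\<close>

text \<open>\<open>R/I\<close> as an \<open>R\<close>-module.\<close>

definition quot_module ::
    "('a, 'b) ring_scheme \<Rightarrow> 'a set \<Rightarrow> ('a, 'a set) module" where
  "quot_module R I =
     \<lparr>carrier = carrier (R Quot I), mult = mult (R Quot I), one = one (R Quot I),
      zero = zero (R Quot I), add = add (R Quot I),
      smult = (\<lambda>r X. rcoset_mult R I (I +>\<^bsub>R\<^esub> r) X)\<rparr>"

text \<open>The submodule \<open>(f\<^sub>1, \<dots>, f\<^sub>r) M\<close> of \<open>M\<close>.\<close>

primrec seq_submodule :: "('a, 'b, 'c) module_scheme \<Rightarrow> 'a list \<Rightarrow> 'b set" where
  "seq_submodule M [] = {\<zero>\<^bsub>M\<^esub>}"
| "seq_submodule M (f # fs) =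
     {(f \<odot>\<^bsub>M\<^esub> x) \<oplus>\<^bsub>M\<^esub> y | x y. x \<in> carrier M \<and> y \<in> seq_submodule M fs}"

text \<open>\<open>M\<close>-regular sequences: the second conjunct says that the \<open>i\<close>-th element is a
  nonzerodivisor on \<open>M\<close> modulo the submodule generated by the preceding elements.\<close>

definition regular_sequence ::
    "('a, 'd) ring_scheme \<Rightarrow> ('a, 'b, 'c) module_scheme \<Rightarrow> 'a list \<Rightarrow> bool" where
  "regular_sequence R M fs \<longleftrightarrow>
     set fs \<subseteq> carrier R \<and>
     (\<forall>i<length fs. \<forall>x\<in>carrier M.
        (fs ! i) \<odot>\<^bsub>M\<^esub> x \<in> seq_submodule M (take i fs)
          \<longrightarrow> x \<in> seq_submodule M (take i fs)) \<and>
     seq_submodule M fs \<noteq> carrier M"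

text \<open>Depth of \<open>M\<close> with respect to the ideal \<open>J\<close>. It is intended for finitely generated
  \<open>M\<close> with \<open>J M \<noteq> M\<close>; for the zero module it gives 0 rather than \<open>\<infinity>\<close>.\<close>

definition depth ::
    "('a, 'd) ring_scheme \<Rightarrow> 'a set \<Rightarrow> ('a, 'b, 'c) module_scheme \<Rightarrow> enat" where
  "depth R J M = Sup {enat (length fs) | fs. set fs \<subseteq> J \<and> regular_sequence R M fs}"


section \<open>Well-formedness\<close>

lemma poly_ring_cring: "cring (poly_ring V :: ('v, 'k::field) mpoly ring)"
proof -
  define C where
    "C = {p :: ('v, 'k) mpoly. \<forall>m\<in>Poly_Mapping.keys p. Poly_Mapping.keys m \<subseteq> V}"
  have R: "poly_ring V = \<lparr>carrier = C, mult = (*), one = 1, zero = 0, add = (+)\<rparr>"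
    by (simp add: poly_ring_def C_def)
  have add: "p + q \<in> C" if "p \<in> C" "q \<in> C" for p q
    using that Poly_Mapping.keys_add[of p q] by (auto simp: C_def)
  have mult: "p * q \<in> C" if "p \<in> C" "q \<in> C" for p q
    unfolding C_def
  proof (clarify)
    fix m x assume "m \<in> Poly_Mapping.keys (p * q)" and x: "x \<in> Poly_Mapping.keys m"
    then obtain a b where "a \<in> Poly_Mapping.keys p" "b \<in> Poly_Mapping.keys q" "m = a + b"
      using keys_mult[of p q] by blast
    then show "x \<in> V" using that x Poly_Mapping.keys_add[of a b] unfolding C_def by blast
  qed
  have uminus: "- p \<in> C" if "p \<in> C" for p
    using that by (auto simp: C_def in_keys_iff)
  have "0 \<in> C" "1 \<in> C"
    by (auto simp: C_def)
  note closed = this add mult uminus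
  have inv: "\<exists>q\<in>C. p + q = 0" if "p \<in> C" for p
    using uminus[OF that] by (intro bexI[of _ "- p"]) simp_all
  show ?thesis
    unfolding R
  proof (rule cringI)
    show "abelian_group \<lparr>carrier = C, mult = (*), one = 1, zero = 0, add = (+)\<rparr>"
      by (rule abelian_groupI) (simp_all add: closed inv add.assoc add.commute)
    show "comm_monoid \<lparr>carrier = C, mult = (*), one = 1, zero = 0, add = (+)\<rparr>"
      by (rule comm_monoidI) (simp_all add: closed mult.assoc mult.commute)
  qed (simp add: distrib_right)
qed

lemma quot_module_module:
  fixes R (structure)
  assumes "cring R" "ideal I R"
  shows "Module.module R (quot_module R I)"
proof -
  interpret I: ideal I R by fact
  interpret R: cring R by fact
  interpret Q: ring "R Quot I" by (rule I.quotient_is_ring)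
  have carr: "carrier (quot_module R I) = {I +> x | x. x \<in> carrier R}"
    by (auto simp: quot_module_def FactRing_simps)
  have sm: "a \<odot>\<^bsub>quot_module R I\<^esub> (I +> x) = I +> a \<otimes> x"
    if "a \<in> carrier R" "x \<in> carrier R" for a x
    using that by (simp add: quot_module_def I.rcoset_mult_add)
  have ad: "(I +> x) \<oplus>\<^bsub>quot_module R I\<^esub> (I +> y) = I +> (x \<oplus> y)"
    if "x \<in> carrier R" "y \<in> carrier R" for x y
    using that by (simp add: quot_module_def FactRing_def I.a_rcos_sum)
  have ab: "abelian_group (quot_module R I)"
  proof (rule abelian_groupI)
    fix x assume "x \<in> carrier (quot_module R I)"
    then have "x \<in> carrier (R Quot I)" by (simp add: quot_module_def)
    from Q.a_inv_closed[OF this] Q.l_neg[OF this]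
    show "\<exists>y\<in>carrier (quot_module R I). y \<oplus>\<^bsub>quot_module R I\<^esub> x = \<zero>\<^bsub>quot_module R I\<^esub>"
      by (auto simp: quot_module_def)
  qed (simp_all add: quot_module_def Q.add.m_ac)
  show ?thesis
  proof (rule Module.moduleI[OF \<open>cring R\<close> ab])
  qed (auto simp: carr sm ad I.l_distr I.r_distr I.m_assoc)
qed

end

theory Submission
  imports Defs "HOL-Computational_Algebra.Polynomial"
begin

text \<open>
  The ideal \<open>I\<close> in question is the Stanley--Reisner ideal of the complex \<open>\<Delta>\<close> of those vertex
  sets that do not contain the vertices of a \<open>q\<close>-matching. Put \<open>d = 2 * q - 1\<close>. Two facts about \<open>\<Delta>\<close>
  determine the depth: every set of at most \<open>d\<close> vertices is a face, since a \<open>q\<close>-matching covers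
  \<open>2 * q\<close> vertices; and \<open>\<Delta>\<close> has a facet with exactly \<open>d\<close> vertices, namely the hub together with
  a path of \<open>2 * q - 2\<close> consecutive rim vertices. The path has a perfect matching, and
  the hub can be matched with any rim vertex that is added (\<open>wheel_q_matching\<close>).

  The first fact gives \<open>depth (R/I) \<ge> d\<close> (\<open>depth_nonface_ideal_ge\<close>). The complete
  homogeneous symmetric polynomials of degrees \<open>1, \<dots>, d\<close> form a regular sequence on \<open>R/I\<close>. This
  goes by induction on the number of variables, through the exact sequence
  \<open>0 \<rightarrow> R/(I : x) \<rightarrow> R/I \<rightarrow> R/(I + (x)) \<rightarrow> 0\<close>. On the right only the remaining variables are left. On the
  left the quotient is a polynomial ring in \<open>x\<close>. There the first polynomial is monic in \<open>x\<close>, and modulo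
  it the recursion \<open>h\<^sub>i(x, y) = h\<^sub>i(y) + x h\<^sub>i\<^sub>-\<^sub>1(x, y)\<close> eliminates \<open>x\<close> from the
  others. The induction therefore runs over \<open>d\<close> consecutive degrees \<open>s, \<dots>, s + d - 1\<close>, with \<open>s\<close>
  arbitrary (\<open>regular_mod_complete_homogeneous\<close>).

  The second fact gives \<open>depth (R/I) \<le> d\<close> (\<open>depth_nonface_ideal_le\<close>). A regular sequence of more
  than \<open>d\<close> elements in the maximal ideal would make the Koszul complex of the variables on \<open>R/I\<close>
  exact in degree \<open>d\<close> (\<open>regular_mod_imp_koszul_exact\<close>). But the squarefree monomial on the facet
  is a cocycle of degree \<open>d\<close>, and it is no coboundary, because the facet lies on the boundary of a
  simplex all of whose proper faces belong to \<open>\<Delta>\<close> (\<open>not_koszul_exact_facet\<close>).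
\<close>

section \<open>Regular sequences modulo a subgroup\<close>

definition diff_closed :: "'a::ab_group_add set \<Rightarrow> bool" where
  "diff_closed S \<longleftrightarrow> 0 \<in> S \<and> (\<forall>a\<in>S. \<forall>b\<in>S. a - b \<in> S)"

text \<open>A quotient module is represented by a pair \<open>B\<close>, \<open>N\<close> of subgroups of one ambient ring, standing for
  \<open>B/N\<close>. The set \<open>enlarge N f B\<close> is \<open>N + f B\<close>, so that dividing \<open>B/N\<close> by the image of \<open>f\<close>
  means replacing \<open>N\<close> by it.\<close>

definition enlarge :: "'a::comm_ring_1 set \<Rightarrow> 'a \<Rightarrow> 'a set \<Rightarrow> 'a set" where
  "enlarge N f B = {n + f * b | n b. n \<in> N \<and> b \<in> B}"

text \<open>Nonzerodivisor conditions only. Recursion on the list absorbs each element into \<open>N\<close>,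
  which matches the way both the vanishing of Koszul cohomology and the regularity of the
  explicit sequence below are proved.\<close>

primrec regular_mod :: "'a::comm_ring_1 set \<Rightarrow> 'a set \<Rightarrow> 'a list \<Rightarrow> bool" where
  "regular_mod B N [] \<longleftrightarrow> True"
| "regular_mod B N (f # fs) \<longleftrightarrow>
     (\<forall>b\<in>B. f * b \<in> N \<longrightarrow> b \<in> N) \<and> regular_mod B (enlarge N f B) fs"

definition stable_pair :: "'a::comm_ring_1 list \<Rightarrow> 'a set \<Rightarrow> 'a set \<Rightarrow> bool" where
  "stable_pair fs B N \<longleftrightarrow> diff_closed B \<and> diff_closed N \<and> N \<subseteq> B \<and>
     (\<forall>f\<in>set fs. (\<forall>b\<in>B. f * b \<in> B) \<and> (\<forall>n\<in>N. f * n \<in> N))"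

lemma diff_closedD:
  assumes "diff_closed S"
  shows "0 \<in> S" and "a \<in> S \<Longrightarrow> b \<in> S \<Longrightarrow> a - b \<in> S"
    and "a \<in> S \<Longrightarrow> - a \<in> S" and "a \<in> S \<Longrightarrow> b \<in> S \<Longrightarrow> a + b \<in> S"
proof -
  show 0: "0 \<in> S" and d: "a \<in> S \<Longrightarrow> b \<in> S \<Longrightarrow> a - b \<in> S" for a b
    using assms by (auto simp: diff_closed_def)
  show m: "a \<in> S \<Longrightarrow> - a \<in> S" for a
    using d[OF 0] by fastforce
  show "a \<in> S \<Longrightarrow> b \<in> S \<Longrightarrow> a + b \<in> S"
    using d[of a "- b"] m[of b] by simp
qed

lemma diff_closed_sum:
  assumes "diff_closed S" "\<And>i. i \<in> A \<Longrightarrow> f i \<in> S"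
  shows "sum f A \<in> S"
  using assms(2)
  by (induction A rule: infinite_finite_induct) (auto intro: diff_closedD[OF assms(1)])

lemma diff_closed_sub_iff:
  assumes "diff_closed S" "a - b \<in> S"
  shows "a \<in> S \<longleftrightarrow> b \<in> S"
  using diff_closedD(2)[OF assms(1), of a "a - b"] diff_closedD(4)[OF assms(1), of "a - b" b] assms(2)
  by auto

lemma enlargeI: "n \<in> N \<Longrightarrow> b \<in> B \<Longrightarrow> n + f * b \<in> enlarge N f B"
  by (auto simp: enlarge_def)

lemma diff_closed_enlarge:
  assumes "diff_closed N" "diff_closed B"
  shows "diff_closed (enlarge N f B)"
  unfolding diff_closed_def
proof (intro conjI ballI)
  show "0 \<in> enlarge N f B"
    using diff_closedD(1)[OF assms(1)] diff_closedD(1)[OF assms(2)]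
    by (force simp: enlarge_def)
  fix a b assume "a \<in> enlarge N f B" "b \<in> enlarge N f B"
  then obtain n c m d where "a = n + f * c" "b = m + f * d" "n \<in> N" "m \<in> N" "c \<in> B" "d \<in> B"
    by (auto simp: enlarge_def)
  then have "a - b = (n - m) + f * (c - d)" "n - m \<in> N" "c - d \<in> B"
    using assms by (auto simp: algebra_simps intro: diff_closedD)
  then show "a - b \<in> enlarge N f B"
    by (auto simp: enlarge_def)
qed

lemma subset_enlarge: "diff_closed B \<Longrightarrow> N \<subseteq> enlarge N f B"
  by (force simp: enlarge_def dest: diff_closedD(1))

lemma mult_mem_enlarge: "diff_closed N \<Longrightarrow> b \<in> B \<Longrightarrow> f * b \<in> enlarge N f B"
  by (force simp: enlarge_def dest: diff_closedD(1))

lemma stable_pair_enlarge: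
  assumes "stable_pair (f # fs) B N"
  shows "stable_pair fs B (enlarge N f B)"
proof -
  have B: "diff_closed B" and N: "diff_closed N" and "N \<subseteq> B"
    and st: "\<And>g b. g \<in> set (f # fs) \<Longrightarrow> b \<in> B \<Longrightarrow> g * b \<in> B"
    and sn: "\<And>g b. g \<in> set (f # fs) \<Longrightarrow> b \<in> N \<Longrightarrow> g * b \<in> N"
    using assms by (auto simp: stable_pair_def)
  have "g * a \<in> enlarge N f B" if "g \<in> set fs" "a \<in> enlarge N f B" for g a
  proof -
    from that obtain n b where "a = n + f * b" "n \<in> N" "b \<in> B" by (auto simp: enlarge_def)
    then have "g * a = g * n + f * (g * b)" "g * n \<in> N" "g * b \<in> B"
      using that st[of g b] sn[of g n] by (simp_all add: algebra_simps)
    then show ?thesis by (auto simp: enlarge_def)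
  qed
  moreover have "enlarge N f B \<subseteq> B"
    using \<open>N \<subseteq> B\<close> st by (auto simp: enlarge_def intro!: diff_closedD(4)[OF B])
  ultimately show ?thesis
    using B N st diff_closed_enlarge by (auto simp: stable_pair_def)
qed

text \<open>Regularity depends only on the quotient \<open>B/N\<close> and on the action of the sequence on it. The map
  \<open>\<phi>\<close> induces an isomorphism from \<open>B/N\<close> to \<open>B'/N'\<close>, and it has to commute with the action only
  modulo \<open>N'\<close>. Since a different ambient ring is allowed, this also compares polynomials
  in one distinguished variable with polynomials in all of them.\<close>

lemma regular_mod_transfer:
  fixes \<phi> :: "'a::comm_ring_1 \<Rightarrow> 'b::comm_ring_1"
  assumes "regular_mod B N fs"
    and "stable_pair fs B N" and "stable_pair fs' B' N'"
    and add: "\<And>a b. \<phi> (a - b) = \<phi> a - \<phi> b"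
    and im: "\<And>b. b \<in> B \<Longrightarrow> \<phi> b \<in> B'"
    and ker: "\<And>b. b \<in> B \<Longrightarrow> \<phi> b \<in> N' \<longleftrightarrow> b \<in> N"
    and onto: "\<And>b'. b' \<in> B' \<Longrightarrow> \<exists>b\<in>B. b' - \<phi> b \<in> N'"
    and "list_all2 (\<lambda>f f'. \<forall>b\<in>B. \<phi> (f * b) - f' * \<phi> b \<in> N') fs fs'"
  shows "regular_mod B' N' fs'"
  using assms(1-3) ker onto assms(8)
proof (induction fs arbitrary: fs' N N')
  case Nil
  then show ?case by simp
next
  case (Cons f fs fs'')
  from Cons.prems(6) obtain f' fs' where fs'': "fs'' = f' # fs'"
    and comm: "\<And>b. b \<in> B \<Longrightarrow> \<phi> (f * b) - f' * \<phi> b \<in> N'"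
    and all2: "list_all2 (\<lambda>f f'. \<forall>b\<in>B. \<phi> (f * b) - f' * \<phi> b \<in> N') fs fs'"
    by (cases fs'') auto
  have B: "diff_closed B" and B': "diff_closed B'" and N: "diff_closed N" "N \<subseteq> B"
    and N': "diff_closed N'"
    and fB: "\<And>b. b \<in> B \<Longrightarrow> f * b \<in> B" and fB': "\<And>b. b \<in> B' \<Longrightarrow> f' * b \<in> B'"
    and fN': "\<And>b. b \<in> N' \<Longrightarrow> f' * b \<in> N'"
    using Cons.prems(2,3)[unfolded fs''] by (auto simp: stable_pair_def)
  note ker = Cons.prems(4) and onto = Cons.prems(5)
  have reg: "b \<in> N" if "b \<in> B" "f * b \<in> N" for b
    using Cons.prems(1) that by simp
  have sub: "N' \<subseteq> enlarge N' f' B'" by (rule subset_enlarge[OF B'])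
  have head: "b' \<in> N'" if b': "b' \<in> B'" "f' * b' \<in> N'" for b'
  proof -
    obtain b where b: "b \<in> B" "b' - \<phi> b \<in> N'" using onto[OF b'(1)] by blast
    have "f' * \<phi> b \<in> N'"
      using diff_closed_sub_iff[OF N', of "f' * b'" "f' * \<phi> b"] fN'[OF b(2)] b'(2)
      by (simp add: algebra_simps)
    with comm[OF b(1)] have "\<phi> (f * b) \<in> N'"
      using diff_closed_sub_iff[OF N'] by blast
    then have "\<phi> b \<in> N'" using ker fB reg b(1) by blast
    then show ?thesis using diff_closed_sub_iff[OF N' b(2)] by blast
  qed
  have ker1: "\<phi> b \<in> enlarge N' f' B' \<longleftrightarrow> b \<in> enlarge N f B" if b: "b \<in> B" for b
  proof
    assume "b \<in> enlarge N f B"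
    then obtain n c where nc: "b = n + f * c" "n \<in> N" "c \<in> B" by (auto simp: enlarge_def)
    have "\<phi> (b - f * c) \<in> N'"
      using nc ker N by auto
    then have "\<phi> b - \<phi> (f * c) + (\<phi> (f * c) - f' * \<phi> c) \<in> N'"
      using comm[OF nc(3)] by (intro diff_closedD(4)[OF N']) (simp_all add: add)
    then have "\<phi> b - f' * \<phi> c \<in> N'" by simp
    moreover have "\<phi> b = (\<phi> b - f' * \<phi> c) + f' * \<phi> c" by simp
    ultimately show "\<phi> b \<in> enlarge N' f' B'"
      unfolding enlarge_def using im[OF nc(3)] by blast
  next
    assume "\<phi> b \<in> enlarge N' f' B'"
    then obtain n' b' where nb: "\<phi> b = n' + f' * b'" "n' \<in> N'" "b' \<in> B'" by (auto simp: enlarge_def)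
    obtain c where c: "c \<in> B" "b' - \<phi> c \<in> N'" using onto[OF nb(3)] by blast
    have "\<phi> (b - f * c) = n' + f' * (b' - \<phi> c) - (\<phi> (f * c) - f' * \<phi> c)"
      by (simp add: add nb algebra_simps)
    also have "\<dots> \<in> N'"
      by (intro diff_closedD(2,4)[OF N'] nb fN' c comm)
    finally have "b - f * c \<in> N"
      using ker[of "b - f * c"] b c fB by (auto intro: diff_closedD(2)[OF B])
    moreover have "b = (b - f * c) + f * c" by simp
    ultimately show "b \<in> enlarge N f B"
      unfolding enlarge_def using c by blast
  qed
  have "regular_mod B' (enlarge N' f' B') fs'"
  proof (rule Cons.IH[of "enlarge N f B"])
    show "list_all2 (\<lambda>g g'. \<forall>b\<in>B. \<phi> (g * b) - g' * \<phi> b \<in> enlarge N' f' B') fs fs'"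
      by (rule list_all2_mono[OF all2]) (simp add: subsetD[OF sub])
    show "regular_mod B (enlarge N f B) fs" using Cons.prems(1) by simp
    show "stable_pair fs B (enlarge N f B)" "stable_pair fs' B' (enlarge N' f' B')"
      using Cons.prems(2,3)[unfolded fs''] by (blast intro: stable_pair_enlarge)+
    show "\<exists>b\<in>B. b' - \<phi> b \<in> enlarge N' f' B'" if "b' \<in> B'" for b'
      using onto[OF that] subsetD[OF sub] by fast
    show "\<phi> b \<in> enlarge N' f' B' \<longleftrightarrow> b \<in> enlarge N f B" if "b \<in> B" for b
      using ker1[OF that] .
  qed
  then show ?case using head by (simp add: fs'')
qed

text \<open>The short exact sequence \<open>0 \<rightarrow> L/N \<rightarrow> B/N \<rightarrow> B/L \<rightarrow> 0\<close>: a sequence regular on both ends is regular in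
  the middle. It stays exact after dividing by \<open>f\<close>, because \<open>f b \<in> L\<close> forces \<open>b \<in> L\<close>, and therefore
  \<open>(N + f B) \<inter> L = N + f L\<close>.\<close>

lemma regular_mod_extension:
  assumes "stable_pair fs B N" "stable_pair fs B L" "stable_pair fs L N"
    and "regular_mod L N fs" "regular_mod B L fs"
  shows "regular_mod B N fs"
  using assms
proof (induction fs arbitrary: N L)
  case Nil
  then show ?case by simp
next
  case (Cons f fs)
  have B: "diff_closed B" and L: "diff_closed L" and N: "diff_closed N" "N \<subseteq> L" "L \<subseteq> B"
    and fL: "\<And>b. b \<in> L \<Longrightarrow> f * b \<in> L"
    using Cons.prems(1-3) by (auto simp: stable_pair_def)
  have regL: "b \<in> N" if "b \<in> L" "f * b \<in> N" for b
    using Cons.prems(4) that by simp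
  have regB: "b \<in> L" if "b \<in> B" "f * b \<in> L" for b
    using Cons.prems(5) that by simp
  let ?L = "enlarge L f B" and ?N = "enlarge N f B"
  have NL: "?N \<subseteq> ?L" using N by (force simp: enlarge_def)
  have mem: "b \<in> ?N \<longleftrightarrow> b \<in> enlarge N f L" if b: "b \<in> L" for b
  proof
    assume "b \<in> ?N"
    then obtain n c where c: "b = n + f * c" "n \<in> N" "c \<in> B" by (auto simp: enlarge_def)
    then have "f * c \<in> L"
      using diff_closedD(2)[OF L b, of n] N by auto
    then have "c \<in> L" using regB c by blast
    then show "b \<in> enlarge N f L" using c by (auto simp: enlarge_def)
  next
    assume "b \<in> enlarge N f L"
    then show "b \<in> ?N" using N by (force simp: enlarge_def)
  qed
  have sp: "stable_pair fs B ?N" "stable_pair fs B ?L" "stable_pair fs L (enlarge N f L)"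
    using Cons.prems(1-3) by (blast intro: stable_pair_enlarge)+
  then have sp': "stable_pair fs ?L ?N"
    using NL by (simp add: stable_pair_def)
  have "regular_mod ?L ?N fs"
  proof (rule regular_mod_transfer[where \<phi> = "\<lambda>b. b" and fs = fs])
    show "regular_mod L (enlarge N f L) fs" using Cons.prems(4) by simp
    show "\<exists>b\<in>L. b' - b \<in> ?N" if "b' \<in> ?L" for b'
    proof -
      from that obtain l c where l: "b' = l + f * c" "l \<in> L" "c \<in> B" by (auto simp: enlarge_def)
      then show ?thesis using mult_mem_enlarge[OF N(1) l(3)] by (auto intro!: bexI[of _ l])
    qed
    show "list_all2 (\<lambda>g g'. \<forall>b\<in>L. g * b - g' * b \<in> ?N) fs fs"
      using diff_closedD(1)[of ?N] sp(1) by (auto simp: stable_pair_def list_all2_conv_all_nth)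
    show "b \<in> ?L" if "b \<in> L" for b using that subset_enlarge[OF B] by blast
  qed (use sp sp' mem in auto)
  moreover have "regular_mod B ?L fs" using Cons.prems(5) by simp
  ultimately have "regular_mod B ?N fs"
    using Cons.IH sp sp' by blast
  then show ?case using regL regB N by auto
qed

lemma enlarge_cong:
  assumes N: "diff_closed N" and fg: "\<And>b. b \<in> B \<Longrightarrow> f * b - g * b \<in> N"
  shows "enlarge N f B = enlarge N g B"
proof -
  have sub: "enlarge N f B \<subseteq> enlarge N g B" if fg: "\<And>b. b \<in> B \<Longrightarrow> f * b - g * b \<in> N" for f g
  proof
    fix a assume "a \<in> enlarge N f B"
    then obtain n b where nb: "a = n + f * b" "n \<in> N" "b \<in> B" by (auto simp: enlarge_def)
    have "(n + (f * b - g * b)) + g * b \<in> enlarge N g B"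
      using fg[OF nb(3)] nb by (intro enlargeI diff_closedD(4)[OF N])
    then show "a \<in> enlarge N g B" using nb(1) by simp
  qed
  have "g * b - f * b \<in> N" if "b \<in> B" for b
    using diff_closedD(3)[OF N fg[OF that]] by simp
  with sub[of f g] sub[of g f] fg show ?thesis by (intro equalityI) simp_all
qed

section \<open>The Koszul complex\<close>

text \<open>Cochains are functions on all subsets of the index set, and a statement about degree \<open>i\<close>
  restricts attention to subsets of cardinality \<open>i\<close>. The differential multiplies by the
  element \<open>\<Sum>k. x k \<cdot> e k\<close> of the exterior algebra, and the contraction is its counterpart for the
  coefficients \<open>g\<close>.\<close>

definition koszul_sign :: "'i::linorder \<Rightarrow> 'i set \<Rightarrow> 'a::comm_ring_1" where
  "koszul_sign k S = (- 1) ^ card {j\<in>S. j < k}"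

definition koszul_diff ::
    "('i::linorder \<Rightarrow> 'a::comm_ring_1) \<Rightarrow> ('i set \<Rightarrow> 'a) \<Rightarrow> 'i set \<Rightarrow> 'a" where
  "koszul_diff x c S = (\<Sum>k\<in>S. koszul_sign k S * x k * c (S - {k}))"

definition koszul_contract ::
    "'i::linorder set \<Rightarrow> ('i \<Rightarrow> 'a::comm_ring_1) \<Rightarrow> ('i set \<Rightarrow> 'a) \<Rightarrow> 'i set \<Rightarrow> 'a" where
  "koszul_contract K g c S = (\<Sum>k\<in>K - S. koszul_sign k S * g k * c (insert k S))"

lemma koszul_sign_insert:
  assumes "finite S" "l \<notin> S"
  shows "koszul_sign k (insert l S) = (if l < k then - koszul_sign k S else koszul_sign k S)"
proof -
  have "{j\<in>insert l S. j < k} = (if l < k then insert l {j\<in>S. j < k} else {j\<in>S. j < k})"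
    by auto
  then show ?thesis using assms by (simp add: koszul_sign_def)
qed

lemma koszul_sign_mult_self [simp]: "koszul_sign k S * koszul_sign k S = 1"
  by (simp add: koszul_sign_def flip: power_mult_distrib)

lemma koszul_sign_insert_self:
  "finite T \<Longrightarrow> koszul_sign k (insert k T) = koszul_sign k T"
  by (cases "k \<in> T") (simp_all add: insert_absorb koszul_sign_insert)

lemma koszul_sign_exchange:
  assumes "finite T" "k \<notin> T" "l \<notin> T" "k \<noteq> l"
  shows "koszul_sign l T * koszul_sign k (insert l T)
       = - (koszul_sign k T * koszul_sign l (insert k T) :: 'a::comm_ring_1)"
    and "koszul_sign l (insert k T) * koszul_sign k (insert l T)
       = - (koszul_sign k T * koszul_sign l T :: 'a::comm_ring_1)"
  using assms(4) by (cases "k < l"; simp add: koszul_sign_insert assms mult.commute not_less_iff_gr_or_eq)+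

text \<open>Contraction by \<open>g\<close> is a homotopy showing that \<open>\<Sum>k. g k * x k\<close> acts as zero on Koszul cohomology.
  The mixed terms, which remove \<open>k\<close> and add \<open>l \<noteq> k\<close>, cancel in pairs; what survives is one term
  for each \<open>k\<close>, coming from the first summand if \<open>k \<in> S\<close> and from the second otherwise.\<close>

lemma koszul_homotopy:
  fixes x g :: "'i::linorder \<Rightarrow> 'a::comm_ring_1"
  assumes K: "finite K" and S: "S \<subseteq> K"
  shows "koszul_diff x (koszul_contract K g c) S + koszul_contract K g (koszul_diff x c) S
       = (\<Sum>k\<in>K. g k * x k) * c S"
proof -
  have fS: "finite S" using K S by (rule rev_finite_subset)
  define A where "A k l = koszul_sign k S * x k * (koszul_sign l (S - {k}) * g l * c (insert l (S - {k})))" for k l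
  define A' where "A' l k = koszul_sign l S * g l * (koszul_sign k (insert l S) * x k * c (insert l S - {k}))" for k l
  have "koszul_diff x (koszul_contract K g c) S = (\<Sum>k\<in>S. \<Sum>l\<in>K - (S - {k}). A k l)"
    by (simp add: koszul_diff_def koszul_contract_def A_def sum_distrib_left)
  also have "\<dots> = (\<Sum>k\<in>S. g k * x k * c S + (\<Sum>l\<in>K - S. A k l))"
  proof (rule sum.cong[OF refl])
    fix k assume k: "k \<in> S"
    then have "K - (S - {k}) = insert k (K - S)" using S by auto
    moreover have "A k k = g k * x k * c S"
    proof -
      have "koszul_sign k (S - {k}) = (koszul_sign k S :: 'a)"
        using koszul_sign_insert_self[of "S - {k}" k, where ?'b = 'a] fS k
        by (simp add: insert_absorb)
      then have "A k k = (koszul_sign k S * koszul_sign k S) * (g k * x k * c S)"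
        using k by (simp add: A_def insert_absorb algebra_simps)
      then show ?thesis by simp
    qed
    ultimately show "(\<Sum>l\<in>K - (S - {k}). A k l) = g k * x k * c S + (\<Sum>l\<in>K - S. A k l)"
      using K k by simp
  qed
  also have "\<dots> = (\<Sum>k\<in>S. g k * x k) * c S + (\<Sum>k\<in>S. \<Sum>l\<in>K - S. A k l)"
    by (simp add: sum.distrib sum_distrib_right)
  finally have dh: "koszul_diff x (koszul_contract K g c) S = \<dots>" .
  have "koszul_contract K g (koszul_diff x c) S = (\<Sum>l\<in>K - S. \<Sum>k\<in>insert l S. A' l k)"
    by (simp add: koszul_diff_def koszul_contract_def A'_def sum_distrib_left)
  also have "\<dots> = (\<Sum>l\<in>K - S. g l * x l * c S + (\<Sum>k\<in>S. A' l k))"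
  proof (rule sum.cong[OF refl])
    fix l assume l: "l \<in> K - S"
    have "A' l l = (koszul_sign l S * koszul_sign l S) * (g l * x l * c S)"
      using l fS by (simp add: A'_def koszul_sign_insert algebra_simps)
    then show "(\<Sum>k\<in>insert l S. A' l k) = g l * x l * c S + (\<Sum>k\<in>S. A' l k)"
      using fS l by simp
  qed
  also have "\<dots> = (\<Sum>k\<in>K - S. g k * x k) * c S + (\<Sum>k\<in>S. \<Sum>l\<in>K - S. A' l k)"
    by (simp only: sum.distrib sum_distrib_right sum.swap[of A' S "K - S"])
  also have "(\<Sum>k\<in>S. \<Sum>l\<in>K - S. A' l k) = (\<Sum>k\<in>S. \<Sum>l\<in>K - S. - A k l)"
  proof (intro sum.cong refl)
    fix k l assume k: "k \<in> S" and l: "l \<in> K - S"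
    define T where "T = S - {k}"
    have T: "finite T" "k \<notin> T" "l \<notin> T" "k \<noteq> l" "S = insert k T"
      using k l fS by (auto simp: T_def)
    have *: "insert l S - {k} = insert l (S - {k})" using T(4) by auto
    have "koszul_sign l (insert k T) * koszul_sign k (insert k (insert l T))
        = - (koszul_sign k (insert k T) * koszul_sign l T :: 'a)"
      using koszul_sign_exchange(2)[OF T(1-4), where ?'a = 'a] T(1)
      by (simp add: koszul_sign_insert_self)
    then have "koszul_sign l S * koszul_sign k (insert l S)
        = - (koszul_sign k S * koszul_sign l (S - {k}) :: 'a)"
    proof -
      have "insert l S = insert k (insert l T)" using T(5) by auto
      then show ?thesis using * T_def T(5) \<open>koszul_sign l (insert k T) * _ = _\<close> by metis
    qed
    then have "koszul_sign l S * koszul_sign k (insert l S) * (g l * x k * c (insert l (S - {k})))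
        = - (koszul_sign k S * koszul_sign l (S - {k})) * (g l * x k * c (insert l (S - {k})))"
      by simp
    then show "A' l k = - A k l"
      unfolding A_def A'_def * by (simp add: algebra_simps)
  qed
  finally have hd: "koszul_contract K g (koszul_diff x c) S
      = (\<Sum>k\<in>K - S. g k * x k) * c S + (\<Sum>k\<in>S. \<Sum>l\<in>K - S. - A k l)" .
  have "(\<Sum>k\<in>K. g k * x k) = (\<Sum>k\<in>S. g k * x k) + (\<Sum>k\<in>K - S. g k * x k)"
    using sum.subset_diff[OF S K] by (simp add: add.commute)
  then show ?thesis unfolding dh hd by (simp add: sum_negf algebra_simps)
qed

lemma koszul_diff_diff:
  fixes x :: "'i::linorder \<Rightarrow> 'a::comm_ring_1"
  assumes fS: "finite S"
  shows "koszul_diff x (koszul_diff x c) S = 0"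
proof -
  define A where "A k l = koszul_sign k S * x k * (koszul_sign l (S - {k}) * x l * c (S - {k} - {l}))" for k l
  have anti: "A k l = - A l k" if "k \<in> S" "l \<in> S" "k \<noteq> l" for k l
  proof -
    define T where "T = S - {k} - {l}"
    have T: "finite T" "k \<notin> T" "l \<notin> T" "k \<noteq> l"
      using that fS by (auto simp: T_def)
    have S: "S - {k} = insert l T" "S - {l} = insert k T" "S = insert k (insert l T)"
        "S = insert l (insert k T)" "S - {l} - {k} = T"
      using that by (auto simp: T_def)
    have "koszul_sign k S = (koszul_sign k (insert l T) :: 'a)"
      by (subst S(3)) (simp add: koszul_sign_insert_self T)
    moreover have "koszul_sign l S = (koszul_sign l (insert k T) :: 'a)"
      by (subst S(4)) (simp add: koszul_sign_insert_self T)
    ultimately have "koszul_sign k S * koszul_sign l (S - {k})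
        = - (koszul_sign l S * koszul_sign k (S - {l}) :: 'a)"
      using koszul_sign_exchange(1)[OF T, where ?'a = 'a] T(1)
      by (simp only: S(1,2) koszul_sign_insert_self mult.commute)
    then have "koszul_sign k S * koszul_sign l (S - {k}) * (x k * x l * c T)
        = - (koszul_sign l S * koszul_sign k (S - {l})) * (x k * x l * c T)" by simp
    then show ?thesis
      unfolding A_def S(5) T_def[symmetric] by (simp only: ac_simps mult_minus_right)
  qed
  \<comment> \<open>Antisymmetry alone would only show that twice the sum is zero. Splitting the pairs
    by the order of \<open>k\<close> and \<open>l\<close> gives the cancellation in characteristic two as well.\<close>
  let ?lo = "\<lambda>k. {l\<in>S. l < k}" and ?hi = "\<lambda>k. {l\<in>S. k < l}"
  have "koszul_diff x (koszul_diff x c) S = (\<Sum>k\<in>S. \<Sum>l\<in>S - {k}. A k l)"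
    by (simp add: koszul_diff_def A_def sum_distrib_left)
  also have "\<dots> = (\<Sum>k\<in>S. (\<Sum>l\<in>?lo k. A k l) + (\<Sum>l\<in>?hi k. A k l))"
  proof (rule sum.cong[OF refl])
    fix k assume "k \<in> S"
    have "S - {k} = ?lo k \<union> ?hi k" by (auto simp: neq_iff)
    moreover have "(\<Sum>l\<in>?lo k \<union> ?hi k. A k l) = (\<Sum>l\<in>?lo k. A k l) + (\<Sum>l\<in>?hi k. A k l)"
      using fS by (intro sum.union_disjoint) auto
    ultimately show "(\<Sum>l\<in>S - {k}. A k l) = (\<Sum>l\<in>?lo k. A k l) + (\<Sum>l\<in>?hi k. A k l)"
      by simp
  qed
  also have "\<dots> = (\<Sum>k\<in>S. \<Sum>l\<in>?lo k. A k l) + (\<Sum>k\<in>S. \<Sum>l\<in>?hi k. A k l)"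
    by (rule sum.distrib)
  also have "(\<Sum>k\<in>S. \<Sum>l\<in>?hi k. A k l) = (\<Sum>l\<in>S. \<Sum>k\<in>?lo l. A k l)"
    using fS by (rule sum.swap_restrict) fact
  also have "\<dots> = (\<Sum>l\<in>S. \<Sum>k\<in>?lo l. - A l k)"
    by (intro sum.cong refl) (use anti in auto)
  finally show ?thesis by (simp add: sum_negf)
qed

section \<open>Vanishing of Koszul cohomology\<close>

definition subring_set :: "'a::comm_ring_1 set \<Rightarrow> bool" where
  "subring_set B \<longleftrightarrow> diff_closed B \<and> 1 \<in> B \<and> (\<forall>a\<in>B. \<forall>b\<in>B. a * b \<in> B)"

definition ideal_set :: "'a::comm_ring_1 set \<Rightarrow> 'a set \<Rightarrow> bool" where
  "ideal_set B N \<longleftrightarrow> diff_closed N \<and> N \<subseteq> B \<and> (\<forall>b\<in>B. \<forall>n\<in>N. b * n \<in> N)"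

lemma ideal_set_enlarge:
  assumes B: "subring_set B" and N: "ideal_set B N" and f: "f \<in> B"
  shows "ideal_set B (enlarge N f B)"
proof -
  have dB: "diff_closed B" and dN: "diff_closed N" and "N \<subseteq> B"
    using B N by (auto simp: subring_set_def ideal_set_def)
  have "enlarge N f B \<subseteq> B"
  proof
    fix a assume "a \<in> enlarge N f B"
    then obtain n b where nb: "a = n + f * b" "n \<in> N" "b \<in> B" by (auto simp: enlarge_def)
    then have "n \<in> B" "f * b \<in> B" using B N f by (auto simp: subring_set_def ideal_set_def)
    then show "a \<in> B" using diff_closedD(4)[OF dB] nb(1) by simp
  qed
  moreover have "c * a \<in> enlarge N f B" if c: "c \<in> B" and a: "a \<in> enlarge N f B" for c a
  proof -
    from a obtain n b where nb: "a = n + f * b" "n \<in> N" "b \<in> B" by (auto simp: enlarge_def)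
    have "c * n + f * (c * b) \<in> enlarge N f B"
      using B N c nb by (intro enlargeI) (auto simp: subring_set_def ideal_set_def)
    then show ?thesis using nb(1) by (simp add: algebra_simps)
  qed
  ultimately show ?thesis
    using diff_closed_enlarge[OF dN dB] by (simp add: ideal_set_def)
qed

lemma koszul_sign_mem:
  assumes "subring_set B" shows "koszul_sign k S \<in> B"
proof -
  have "(-1) ^ n \<in> B" for n :: nat
    using assms by (induction n) (auto simp: subring_set_def dest: diff_closedD(3))
  then show ?thesis by (simp add: koszul_sign_def)
qed

lemma koszul_term_mem:
  assumes "subring_set B" and "ideal_set B N" and "y \<in> B" and "z \<in> N"
  shows "koszul_sign k S * y * z \<in> N"
  using assms koszul_sign_mem[OF assms(1), of k S] by (auto simp: subring_set_def ideal_set_def)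

text \<open>Exactness of the Koszul complex of \<open>B/N\<close> in degree \<open>i\<close>, with cochains lifted to \<open>B\<close>. In degree
  zero the only subset is empty and the differential vanishes there, so the condition says that
  an element of \<open>B/N\<close> killed by all \<open>x k\<close> is zero.\<close>

definition koszul_exact ::
    "'i::linorder set \<Rightarrow> ('i \<Rightarrow> 'a::comm_ring_1) \<Rightarrow> 'a set \<Rightarrow> 'a set \<Rightarrow> nat \<Rightarrow> bool" where
  "koszul_exact K x B N i \<longleftrightarrow>
     (\<forall>c. (\<forall>S. c S \<in> B) \<longrightarrow> (\<forall>S\<subseteq>K. card S = Suc i \<longrightarrow> koszul_diff x c S \<in> N) \<longrightarrow>
        (\<exists>b. (\<forall>S. b S \<in> B) \<and> (\<forall>S\<subseteq>K. card S = i \<longrightarrow> c S - koszul_diff x b S \<in> N)))"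

text \<open>Depth sensitivity of the Koszul complex, in the direction that bounds depth from above: a
  regular sequence of length \<open>r\<close> inside the ideal generated by the \<open>x k\<close> forces cohomology to vanish
  in all degrees below \<open>r\<close>. Usually this is read off the long exact sequence for
  multiplication by the first element \<open>f\<close>, which is injective on cohomology by exactness one
  degree lower for \<open>B/(N + f B)\<close>, and zero by the homotopy. The proof carries this out on
  cochains. For a cocycle \<open>c\<close>, the element \<open>f c\<close> is the boundary of the contraction \<open>h c\<close>; the
  induction hypothesis writes \<open>h c\<close> as a boundary plus \<open>f y\<close>; hence \<open>f (c - d y)\<close> is zero
  modulo \<open>N\<close> and \<open>f\<close> can be cancelled.\<close>

lemma regular_mod_imp_koszul_exact:
  fixes x :: "'i::linorder \<Rightarrow> 'a::comm_ring_1"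
  assumes B: "subring_set B" and N: "ideal_set B N" and K: "finite K"
    and xB: "\<And>k. k \<in> K \<Longrightarrow> x k \<in> B"
    and gen: "\<And>f. f \<in> set fs \<Longrightarrow> \<exists>g. (\<forall>k. g k \<in> B) \<and> f = (\<Sum>k\<in>K. g k * x k)"
    and "regular_mod B N fs" and "i < length fs"
  shows "koszul_exact K x B N i"
  using N gen assms(6,7)
proof (induction fs arbitrary: N i)
  case Nil
  then show ?case by simp
next
  case (Cons f fs)
  have dB: "diff_closed B" and BB: "ideal_set B B" using B by (auto simp: subring_set_def ideal_set_def)
  have dN: "diff_closed N" using Cons.prems(1) by (simp add: ideal_set_def)
  obtain g where g: "\<And>k. g k \<in> B" "f = (\<Sum>k\<in>K. g k * x k)"
    using Cons.prems(2)[of f] by auto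
  have fB: "f \<in> B"
    unfolding g(2) by (rule diff_closed_sum[OF dB]) (use B g xB in \<open>auto simp: subring_set_def\<close>)
  let ?d = "koszul_diff x" and ?h = "koszul_contract K g"
  have d_mem: "?d c S \<in> M" if "ideal_set B M" "\<And>S'. S' \<subseteq> S \<Longrightarrow> card S' = card S - 1 \<Longrightarrow> c S' \<in> M" "S \<subseteq> K" for c S M
    unfolding koszul_diff_def
    using that xB B finite_subset[OF that(3) K]
    by (intro diff_closed_sum koszul_term_mem[of B]) (auto simp: ideal_set_def)
  have h_mem: "?h c S \<in> M" if "ideal_set B M" "\<And>k. k \<in> K - S \<Longrightarrow> c (insert k S) \<in> M" for c S M
    unfolding koszul_contract_def
    using that g(1) B by (intro diff_closed_sum koszul_term_mem[of B]) (auto simp: ideal_set_def)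
  show ?case
    unfolding koszul_exact_def
  proof (intro allI impI)
    fix c :: "'i set \<Rightarrow> 'a"
    assume c: "\<forall>S. c S \<in> B" and dc: "\<forall>S\<subseteq>K. card S = Suc i \<longrightarrow> ?d c S \<in> N"
    have hom: "f * c S - ?d (?h c) S \<in> N" if S: "S \<subseteq> K" "card S = i" for S
    proof -
      have "finite S" using S(1) K by (rule finite_subset)
      then have "?h (?d c) S \<in> N"
        using S dc by (intro h_mem Cons.prems(1)) auto
      moreover have "f * c S - ?d (?h c) S = ?h (?d c) S"
        using koszul_homotopy[OF K S(1), of x g c] by (simp add: g(2) algebra_simps)
      ultimately show ?thesis by simp
    qed
    have reg: "b \<in> N" if "b \<in> B" "f * b \<in> N" for b
      using Cons.prems(3) that by simp
    show "\<exists>b. (\<forall>S. b S \<in> B) \<and> (\<forall>S\<subseteq>K. card S = i \<longrightarrow> c S - ?d b S \<in> N)"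
    proof (cases i)
      case 0
      have "c S - ?d (\<lambda>_. 0) S \<in> N" if "S \<subseteq> K" "card S = i" for S
      proof -
        have "S = {}" using that 0 K by (auto dest: finite_subset)
        then show ?thesis using hom[OF that] reg c by (simp add: koszul_diff_def)
      qed
      then show ?thesis using diff_closedD(1)[OF dB] by (intro exI[of _ "\<lambda>_. 0"]) simp
    next
      case (Suc j)
      let ?N = "enlarge N f B"
      have N1: "ideal_set B ?N" by (rule ideal_set_enlarge[OF B Cons.prems(1) fB])
      have "koszul_exact K x B ?N j"
        using Cons.IH[OF N1] Cons.prems(2-4) Suc by auto
      moreover have "\<forall>S. ?h c S \<in> B" using h_mem[OF BB] c by blast
      moreover have "?d (?h c) S \<in> ?N" if S: "S \<subseteq> K" "card S = Suc j" for S
      proof -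
        have "- (f * c S - ?d (?h c) S) + f * c S \<in> ?N"
          using hom[of S] S Suc c by (intro enlargeI diff_closedD(3)[OF dN]) auto
        then show ?thesis by simp
      qed
      ultimately obtain b where b: "\<And>S. b S \<in> B"
        and hb: "\<And>S. S \<subseteq> K \<Longrightarrow> card S = j \<Longrightarrow> ?h c S - ?d b S \<in> ?N"
        unfolding koszul_exact_def by blast
      \<comment> \<open>The cochain must take values in \<open>B\<close> on every set, also where the congruence is not claimed.\<close>
      define y where "y S = (SOME e. e \<in> B \<and> (S \<subseteq> K \<and> card S = j \<longrightarrow> ?h c S - ?d b S - f * e \<in> N))" for S
      have y: "y S \<in> B \<and> (S \<subseteq> K \<and> card S = j \<longrightarrow> ?h c S - ?d b S - f * y S \<in> N)" for S
        unfolding y_def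
      proof (rule someI_ex, cases "S \<subseteq> K \<and> card S = j")
        case True
        then obtain n e where ne: "?h c S - ?d b S = n + f * e" "n \<in> N" "e \<in> B"
          using hb[of S] by (auto simp: enlarge_def)
        then show "\<exists>e. e \<in> B \<and> (S \<subseteq> K \<and> card S = j \<longrightarrow> ?h c S - ?d b S - f * e \<in> N)"
          by (intro exI[of _ e]) simp
      qed (use diff_closedD(1)[OF dB] in auto)
      have "c S - ?d y S \<in> N" if S: "S \<subseteq> K" "card S = i" for S
      proof -
        have fS: "finite S" using S(1) K by (rule finite_subset)
        have "?d (\<lambda>S. ?h c S - ?d b S - f * y S) S \<in> N"
          using S Suc by (intro d_mem Cons.prems(1) conjunct2[OF y, rule_format]) auto
        also have "?d (\<lambda>S. ?h c S - ?d b S - f * y S) S = ?d (?h c) S - ?d (?d b) S - f * ?d y S"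
          unfolding koszul_diff_def[of x "\<lambda>S. ?h c S - ?d b S - f * y S"] koszul_diff_def[of x "?h c"]
            koszul_diff_def[of x "?d b"] koszul_diff_def[of x y]
          by (simp only: right_diff_distrib sum_subtractf sum_distrib_left ac_simps)
        finally have "(f * c S - ?d (?h c) S) + (?d (?h c) S - f * ?d y S) \<in> N"
          using hom[OF S] koszul_diff_diff[OF fS, of x b] by (intro diff_closedD(4)[OF dN]) simp_all
        then have "f * (c S - ?d y S) \<in> N" by (simp add: algebra_simps)
        moreover have "c S - ?d y S \<in> B"
          using c y S by (intro diff_closedD(2)[OF dB] d_mem[OF BB]) auto
        ultimately show ?thesis by (rule reg[rotated])
      qed
      then show ?thesis using y by blast
    qed
  qed
qed

section \<open>Monic polynomials and regular sequences\<close>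

lemma stable_pairI:
  assumes "subring_set B" "ideal_set B N" "set fs \<subseteq> B"
  shows "stable_pair fs B N"
  using assms by (auto simp: stable_pair_def subring_set_def ideal_set_def)

definition coeffs_in :: "'a::comm_ring_1 set \<Rightarrow> 'a poly set" where
  "coeffs_in N = {q. \<forall>i. coeff q i \<in> N}"

text \<open>For monic \<open>p\<close> of degree \<open>s\<close> over \<open>A\<close>, the polynomials of degree below \<open>s\<close> represent \<open>A[X]/(p)\<close>, a free
  \<open>A\<close>-module.\<close>

definition coeffs_in_below :: "'a::comm_ring_1 set \<Rightarrow> nat \<Rightarrow> 'a poly set" where
  "coeffs_in_below N s = {q \<in> coeffs_in N. \<forall>i\<ge>s. coeff q i = 0}"

lemma diff_closed_coeffs_in: "diff_closed N \<Longrightarrow> diff_closed (coeffs_in N)"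
  by (auto simp: diff_closed_def coeffs_in_def)

lemma diff_closed_coeffs_in_below: "diff_closed N \<Longrightarrow> diff_closed (coeffs_in_below N s)"
  by (auto simp: diff_closed_def coeffs_in_def coeffs_in_below_def)

lemma coeffs_in_mult:
  assumes "ideal_set A N" "p \<in> coeffs_in A" "q \<in> coeffs_in N"
  shows "p * q \<in> coeffs_in N"
  using assms by (auto simp: coeffs_in_def coeff_mult ideal_set_def intro!: diff_closed_sum)

lemma subring_set_coeffs_in:
  assumes "subring_set A" shows "subring_set (coeffs_in A)"
proof -
  have "ideal_set A A" using assms by (simp add: subring_set_def ideal_set_def)
  then show ?thesis
    using assms coeffs_in_mult[of A A] diff_closed_coeffs_in[of A] diff_closedD(1)[of A]
    by (simp add: subring_set_def) (simp add: coeffs_in_def coeff_1)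
qed

lemma ideal_set_coeffs_in:
  assumes "ideal_set A N" shows "ideal_set (coeffs_in A) (coeffs_in N)"
  using assms coeffs_in_mult[OF assms] diff_closed_coeffs_in
  by (auto simp: ideal_set_def coeffs_in_def)

text \<open>Modulo \<open>N\<close>, the leading coefficient of \<open>p * q\<close> is that of \<open>q\<close>. Working down from the top degree,
  this recovers every coefficient of \<open>q\<close> from the coefficients of \<open>p * q\<close> in degrees at least \<open>s\<close>.
  Allowing arbitrary lower coefficients in \<open>p * q\<close> gives both that \<open>p\<close> is a nonzerodivisor and
  that remainders modulo \<open>p\<close> are unique.\<close>

lemma monic_mult_cancel:
  assumes A: "subring_set A" and N: "ideal_set A N" and pA: "p \<in> coeffs_in A"
    and top: "coeff p s = 1" and above: "\<And>i. i > s \<Longrightarrow> coeff p i = 0"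
    and pq: "\<And>i. i \<ge> s \<Longrightarrow> coeff (p * q) i \<in> N"
  shows "q \<in> coeffs_in N"
proof -
  have dN: "diff_closed N" using N by (simp add: ideal_set_def)
  have "coeff q j \<in> N" for j
  proof (induction "degree q - j" arbitrary: j rule: less_induct)
    case less
    have IH: "coeff q j' \<in> N" if "j' > j" for j'
    proof (cases "j' > degree q")
      case True
      then show ?thesis using diff_closedD(1)[OF dN] by (simp add: coeff_eq_0)
    next
      case False
      then show ?thesis using that by (intro less) auto
    qed
    let ?t = "\<lambda>i. coeff p i * coeff q (s + j - i)"
    have "coeff (p * q) (s + j) = ?t s + (\<Sum>i\<in>{..s + j} - {s}. ?t i)"
      unfolding coeff_mult by (rule sum.remove) auto
    then have "coeff q j = coeff (p * q) (s + j) - (\<Sum>i\<in>{..s + j} - {s}. ?t i)"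
      using top by simp
    moreover have "(\<Sum>i\<in>{..s + j} - {s}. ?t i) \<in> N"
    proof (rule diff_closed_sum[OF dN])
      fix i assume i: "i \<in> {..s + j} - {s}"
      show "?t i \<in> N"
      proof (cases "i < s")
        case True
        then show ?thesis using IH[of "s + j - i"] N pA by (auto simp: ideal_set_def coeffs_in_def)
      next
        case False
        then show ?thesis using i above[of i] diff_closedD(1)[OF dN] by simp
      qed
    qed
    ultimately show ?case using pq[of "s + j"] diff_closedD(2)[OF dN] by simp
  qed
  then show ?thesis by (simp add: coeffs_in_def)
qed

lemma monic_division:
  assumes A: "subring_set A" and pA: "p \<in> coeffs_in A"
    and top: "coeff p s = 1" and above: "\<And>i. i > s \<Longrightarrow> coeff p i = 0"
    and q: "q \<in> coeffs_in A"
  shows "\<exists>r\<in>coeffs_in_below A s. \<exists>c\<in>coeffs_in A. q = r + p * c"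
proof -
  have dA: "diff_closed A" and AA: "ideal_set A A" using A by (auto simp: subring_set_def ideal_set_def)
  note dC = diff_closed_coeffs_in[OF dA]
  have "\<exists>r\<in>coeffs_in_below A s. \<exists>c\<in>coeffs_in A. q = r + p * c"
    if "q \<in> coeffs_in A" "\<And>i. i \<ge> n \<Longrightarrow> coeff q i = 0" for q n
    using that
  proof (induction n arbitrary: q)
    case 0
    then show ?case
      using diff_closedD(1)[OF dC] by (intro bexI[of _ q] bexI[of _ 0]) (auto simp: coeffs_in_below_def)
  next
    case (Suc n)
    show ?case
    proof (cases "s \<le> n")
      case False
      then show ?thesis
        using Suc.prems diff_closedD(1)[OF dC]
        by (intro bexI[of _ q] bexI[of _ 0]) (auto simp: coeffs_in_below_def)
    next
      case True
      let ?m = "monom (coeff q n) (n - s)"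
      have m: "?m \<in> coeffs_in A"
        using Suc.prems(1) diff_closedD(1)[OF dA] by (auto simp: coeffs_in_def)
      have "q - p * ?m \<in> coeffs_in A"
        using Suc.prems(1) coeffs_in_mult[OF AA pA m] by (rule diff_closedD(2)[OF dC])
      moreover have "coeff (q - p * ?m) i = 0" if "i \<ge> n" for i
      proof (cases "i = n")
        case True
        then show ?thesis using \<open>s \<le> n\<close> top by (simp add: mult.commute[of p] coeff_monom_mult)
      next
        case False
        then have "coeff p (i - (n - s)) = 0" using that \<open>s \<le> n\<close> by (intro above) linarith
        then show ?thesis using that False Suc.prems(2)[of i] by (simp add: mult.commute[of p] coeff_monom_mult)
      qed
      ultimately obtain r c where rc: "r \<in> coeffs_in_below A s" "c \<in> coeffs_in A" "q - p * ?m = r + p * c"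
        using Suc.IH by blast
      then have "q = r + p * (c + ?m)" by (simp add: algebra_simps)
      then show ?thesis using rc diff_closedD(4)[OF dC rc(2) m] by blast
    qed
  qed
  from this[OF q, of "Suc (degree q)"] show ?thesis by (simp add: coeff_eq_0)
qed

lemma regular_mod_coeffs_in_below:
  assumes "regular_mod A N gs" "stable_pair gs A N"
  shows "regular_mod (coeffs_in_below A s) (coeffs_in_below N s) (map (\<lambda>g. [:g:]) gs)"
  using assms
proof (induction gs arbitrary: N)
  case Nil
  then show ?case by simp
next
  case (Cons g gs)
  have dA: "diff_closed A" and dN: "diff_closed N"
    using Cons.prems(2) by (auto simp: stable_pair_def)
  let ?E = "enlarge N g A"
  have "enlarge (coeffs_in_below N s) [:g:] (coeffs_in_below A s) = coeffs_in_below ?E s"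
  proof (intro equalityI subsetI)
    fix q assume "q \<in> enlarge (coeffs_in_below N s) [:g:] (coeffs_in_below A s)"
    then obtain n a where "q = n + [:g:] * a" "n \<in> coeffs_in_below N s" "a \<in> coeffs_in_below A s"
      by (auto simp: enlarge_def)
    then show "q \<in> coeffs_in_below ?E s"
      by (auto simp: coeffs_in_below_def coeffs_in_def intro: enlargeI)
  next
    fix q assume q: "q \<in> coeffs_in_below ?E s"
    then have "\<forall>i. \<exists>n a. coeff q i = n + g * a \<and> n \<in> N \<and> a \<in> A"
      by (auto simp: coeffs_in_below_def coeffs_in_def enlarge_def)
    then obtain n a where na: "\<And>i. coeff q i = n i + g * a i" "\<And>i. n i \<in> N" "\<And>i. a i \<in> A"
      by metis
    let ?n = "\<Sum>i<s. monom (n i) i" and ?a = "\<Sum>i<s. monom (a i) i"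
    have c: "coeff (\<Sum>i<s. monom (f i) i) j = (if j < s then f j else 0)" for f :: "nat \<Rightarrow> 'a" and j
      by (simp add: coeff_sum)
    have "?n \<in> coeffs_in_below N s" "?a \<in> coeffs_in_below A s"
      using na diff_closedD(1)[OF dN] diff_closedD(1)[OF dA]
      by (auto simp: coeffs_in_below_def coeffs_in_def c)
    moreover have "q = ?n + [:g:] * ?a"
      using q na(1) by (intro poly_eqI) (auto simp: c coeffs_in_below_def)
    ultimately show "q \<in> enlarge (coeffs_in_below N s) [:g:] (coeffs_in_below A s)"
      by (metis enlargeI)
  qed
  moreover have "regular_mod (coeffs_in_below A s) (coeffs_in_below ?E s) (map (\<lambda>g. [:g:]) gs)"
    using Cons.prems by (intro Cons.IH stable_pair_enlarge) auto
  moreover have "b \<in> coeffs_in_below N s"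
    if "b \<in> coeffs_in_below A s" "[:g:] * b \<in> coeffs_in_below N s" for b
    using that Cons.prems(1) by (auto simp: coeffs_in_below_def coeffs_in_def)
  ultimately show ?case by simp
qed

text \<open>A monic polynomial can be put in front of a sequence that is regular on \<open>A/N\<close>: the quotient of
  \<open>(A/N)[X]\<close> by it is a direct sum of copies of \<open>A/N\<close>.\<close>

lemma regular_mod_monic:
  assumes A: "subring_set A" and N: "ideal_set A N" and pA: "p \<in> coeffs_in A"
    and top: "coeff p s = 1" and above: "\<And>i. i > s \<Longrightarrow> coeff p i = 0"
    and gs: "set gs \<subseteq> A" and reg: "regular_mod A N gs"
  shows "regular_mod (coeffs_in A) (coeffs_in N) (p # map (\<lambda>g. [:g:]) gs)"
proof -
  let ?C = "coeffs_in A" and ?D = "coeffs_in N" and ?gs = "map (\<lambda>g. [:g:]) gs"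
  let ?E = "enlarge ?D p ?C"
  have dA: "diff_closed A" and dN: "diff_closed N" and "N \<subseteq> A"
    using A N by (auto simp: subring_set_def ideal_set_def)
  note dD = diff_closed_coeffs_in[OF dN]
  have cancel: "q \<in> ?D" if "\<And>i. i \<ge> s \<Longrightarrow> coeff (p * q) i \<in> N" for q
    by (rule monic_mult_cancel[OF A N pA top]) (use above that in auto)
  have sp0: "stable_pair gs A N" by (rule stable_pairI[OF A N gs])
  have gC: "set (p # ?gs) \<subseteq> ?C"
    using gs pA diff_closedD(1)[OF dA] by (auto simp: coeffs_in_def coeff_pCons split: nat.split)
  have "regular_mod ?C ?E ?gs"
  proof (rule regular_mod_transfer[where \<phi> = "\<lambda>q. q"])
    show "regular_mod (coeffs_in_below A s) (coeffs_in_below N s) ?gs"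
      by (rule regular_mod_coeffs_in_below[OF reg sp0])
    show "stable_pair ?gs (coeffs_in_below A s) (coeffs_in_below N s)"
      using sp0 diff_closed_coeffs_in_below[OF dA] diff_closed_coeffs_in_below[OF dN]
      by (auto simp: stable_pair_def coeffs_in_below_def coeffs_in_def)
    show sp: "stable_pair ?gs ?C ?E"
      by (rule stable_pair_enlarge, rule stable_pairI[OF _ _ gC])
        (auto intro: A N subring_set_coeffs_in ideal_set_coeffs_in)
    show "list_all2 (\<lambda>f f'. \<forall>b\<in>coeffs_in_below A s. f * b - f' * b \<in> ?E) ?gs ?gs"
      using sp diff_closedD(1)[of ?E] by (auto simp: stable_pair_def list_all2_conv_all_nth)
    show "\<exists>r\<in>coeffs_in_below A s. q - r \<in> ?E" if q: "q \<in> ?C" for q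
    proof -
      obtain r c where rc: "r \<in> coeffs_in_below A s" "c \<in> ?C" "q = r + p * c"
        using monic_division[OF A pA top _ q] above by blast
      then have "q - r \<in> ?E" using mult_mem_enlarge[OF dD rc(2), of p] by simp
      then show ?thesis using rc(1) by blast
    qed
    show "r \<in> ?C" if "r \<in> coeffs_in_below A s" for r
      using that by (simp add: coeffs_in_below_def)
    show "r \<in> ?E \<longleftrightarrow> r \<in> coeffs_in_below N s" if r: "r \<in> coeffs_in_below A s" for r
    proof
      assume "r \<in> ?E"
      then obtain d c where dc: "r = d + p * c" "d \<in> ?D" "c \<in> ?C" by (auto simp: enlarge_def)
      have "coeff (p * c) i \<in> N" if "i \<ge> s" for i
      proof -
        have "coeff (p * c) i = - coeff d i"
          using r that dc(1) by (auto simp: coeffs_in_below_def add_eq_0_iff)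
        then show ?thesis using dc(2) diff_closedD(3)[OF dN] by (simp add: coeffs_in_def)
      qed
      then have "c \<in> ?D" by (rule cancel)
      then have "p * c \<in> ?D" by (rule coeffs_in_mult[OF N pA])
      then have "r \<in> ?D" using dc diff_closedD(4)[OF dD] by simp
      then show "r \<in> coeffs_in_below N s" using r by (simp add: coeffs_in_below_def)
    next
      assume "r \<in> coeffs_in_below N s"
      then show "r \<in> ?E"
        using subset_enlarge[OF diff_closed_coeffs_in[OF dA]] by (auto simp: coeffs_in_below_def)
    qed
  qed simp
  moreover have "b \<in> ?D" if "p * b \<in> ?D" for b
    using that by (intro cancel) (simp add: coeffs_in_def)
  ultimately show ?thesis by simp
qed

text \<open>The recursion makes \<open>u (i + 1)\<close> and \<open>v (i + 1)\<close> agree modulo \<open>u i\<close>, so once \<open>u s\<close> has been divided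
  out, the later elements of \<open>u\<close> can be exchanged one by one for those of \<open>v\<close>.\<close>

lemma regular_mod_shift:
  fixes u v :: "nat \<Rightarrow> 'a::comm_ring_1"
  assumes B: "subring_set B" and X: "X \<in> B" and uB: "\<And>i. u i \<in> B"
    and rec: "\<And>i. u (Suc i) = v (Suc i) + X * u i"
    and "ideal_set B N" "u s \<in> N" "regular_mod B N (map v [Suc s..<Suc s + e])"
  shows "regular_mod B N (map u [Suc s..<Suc s + e])"
  using assms(5-)
proof (induction e arbitrary: s N)
  case 0
  then show ?case by simp
next
  case (Suc e)
  have up: "[Suc s..<Suc s + Suc e] = Suc s # [Suc (Suc s)..<Suc (Suc s) + e]"
    by (simp add: upt_conv_Cons)
  have dN: "diff_closed N" and dB: "diff_closed B" using Suc.prems(1) B by (auto simp: ideal_set_def subring_set_def)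
  have diff: "u (Suc s) * b - v (Suc s) * b \<in> N" if "b \<in> B" for b
  proof -
    have "(X * b) * u s \<in> N"
      using Suc.prems(1,2) that X B by (auto simp: ideal_set_def subring_set_def)
    then show ?thesis by (simp add: rec algebra_simps)
  qed
  have reg: "\<forall>b\<in>B. v (Suc s) * b \<in> N \<longrightarrow> b \<in> N"
    "regular_mod B (enlarge N (v (Suc s)) B) (map v [Suc (Suc s)..<Suc (Suc s) + e])"
    using Suc.prems(3) unfolding up by simp_all
  have eq: "enlarge N (v (Suc s)) B = enlarge N (u (Suc s)) B"
    by (rule enlarge_cong[OF dN, symmetric]) (rule diff)
  have "regular_mod B (enlarge N (u (Suc s)) B) (map u [Suc (Suc s)..<Suc (Suc s) + e])"
  proof (rule Suc.IH)
    show "ideal_set B (enlarge N (u (Suc s)) B)" by (rule ideal_set_enlarge[OF B Suc.prems(1) uB])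
    show "u (Suc s) \<in> enlarge N (u (Suc s)) B"
      using mult_mem_enlarge[OF dN, of 1 B "u (Suc s)"] B by (simp add: subring_set_def)
  qed (use reg(2) eq in simp)
  moreover have "b \<in> N" if "b \<in> B" "u (Suc s) * b \<in> N" for b
    using diff_closed_sub_iff[OF dN diff[OF that(1)]] that reg(1) by blast
  ultimately show ?case unfolding up by simp
qed

section \<open>Ideals of nonfaces\<close>

definition polys_in :: "'v set \<Rightarrow> ('v, 'k::field) mpoly set" where
  "polys_in V = {p. \<forall>m\<in>Poly_Mapping.keys p. Poly_Mapping.keys m \<subseteq> V}"

text \<open>For a simplicial complex \<open>\<Delta>\<close> this is its Stanley--Reisner ideal, presented by the supports of the
  monomials that occur.\<close>

definition nonface_ideal :: "'v set \<Rightarrow> 'v set set \<Rightarrow> ('v, 'k::field) mpoly set" where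
  "nonface_ideal V \<Delta> = {p \<in> polys_in V. \<forall>m\<in>Poly_Mapping.keys p. Poly_Mapping.keys m \<notin> \<Delta>}"

definition down_closed :: "'v set set \<Rightarrow> bool" where
  "down_closed \<Delta> \<longleftrightarrow> (\<forall>F\<in>\<Delta>. \<forall>G\<subseteq>F. G \<in> \<Delta>)"

lemma keys_diff_subset: "Poly_Mapping.keys (p - q) \<subseteq> Poly_Mapping.keys p \<union> Poly_Mapping.keys q"
  for p q :: "'a \<Rightarrow>\<^sub>0 'b::ab_group_add"
  by (auto simp: in_keys_iff lookup_minus)

lemma keys_add_nat: "Poly_Mapping.keys (m + n) = Poly_Mapping.keys m \<union> Poly_Mapping.keys n"
  for m n :: "'v \<Rightarrow>\<^sub>0 nat"
  by (auto simp: in_keys_iff lookup_add)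

lemma keys_mult_monomials:
  assumes "m \<in> Poly_Mapping.keys (p * q)"
  obtains a b where "m = a + b" "a \<in> Poly_Mapping.keys p" "b \<in> Poly_Mapping.keys q"
  using keys_mult[of p q] assms by blast

lemma subring_set_polys_in: "subring_set (polys_in V :: ('v, 'k::field) mpoly set)"
proof -
  have "p * q \<in> polys_in V" if "p \<in> polys_in V" "q \<in> polys_in V" for p q :: "('v, 'k) mpoly"
    using that unfolding polys_in_def by (fastforce simp: keys_add_nat elim!: keys_mult_monomials)
  moreover have "diff_closed (polys_in V :: ('v, 'k) mpoly set)"
    using keys_diff_subset by (fastforce simp: polys_in_def diff_closed_def)
  moreover have "1 \<in> (polys_in V :: ('v, 'k) mpoly set)"
    by (simp add: polys_in_def)
  ultimately show ?thesis by (simp add: subring_set_def)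
qed

lemma ideal_set_nonface_ideal:
  assumes "down_closed \<Delta>"
  shows "ideal_set (polys_in V) (nonface_ideal V \<Delta> :: ('v, 'k::field) mpoly set)"
proof -
  have "diff_closed (nonface_ideal V \<Delta> :: ('v, 'k) mpoly set)"
    using keys_diff_subset by (fastforce simp: polys_in_def nonface_ideal_def diff_closed_def)
  moreover have "p * q \<in> nonface_ideal V \<Delta>"
    if p: "p \<in> polys_in V" and q: "q \<in> nonface_ideal V \<Delta>" for p q :: "('v, 'k) mpoly"
    unfolding nonface_ideal_def
  proof (intro CollectI conjI ballI)
    show "p * q \<in> polys_in V"
      using p q subring_set_polys_in[of V] by (auto simp: nonface_ideal_def subring_set_def)
    fix m assume "m \<in> Poly_Mapping.keys (p * q)"
    then obtain a b where "m = a + b" "b \<in> Poly_Mapping.keys q" by (rule keys_mult_monomials)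
    then show "Poly_Mapping.keys m \<notin> \<Delta>"
      using q assms by (auto simp: keys_add_nat nonface_ideal_def down_closed_def)
  qed
  ultimately show ?thesis by (auto simp: ideal_set_def nonface_ideal_def)
qed

lemma sum_monomials: "p = (\<Sum>m\<in>Poly_Mapping.keys p. Poly_Mapping.single m (Poly_Mapping.lookup p m))"
  by (rule poly_mapping_eqI)
    (auto simp: lookup_sum lookup_single when_def in_keys_iff sum.delta' if_distrib cong: if_cong)

lemma lookup_single_times:
  fixes p :: "('v \<Rightarrow>\<^sub>0 nat) \<Rightarrow>\<^sub>0 'k::comm_ring_1"
  shows "Poly_Mapping.lookup (Poly_Mapping.single t c * p) (t + m) = c * Poly_Mapping.lookup p m"
proof -
  have "Poly_Mapping.single t c * p
      = (\<Sum>a\<in>Poly_Mapping.keys p. Poly_Mapping.single (t + a) (c * Poly_Mapping.lookup p a))"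
    by (subst sum_monomials[of p]) (simp add: sum_distrib_left mult_single)
  then show ?thesis
    by (auto simp: lookup_sum lookup_single when_def in_keys_iff sum.delta' cong: if_cong)
qed

lemma keys_single_times:
  fixes p :: "('v \<Rightarrow>\<^sub>0 nat) \<Rightarrow>\<^sub>0 'k::comm_ring_1"
  shows "Poly_Mapping.keys (Poly_Mapping.single t 1 * p) = (+) t ` Poly_Mapping.keys p"
proof (intro equalityI subsetI)
  fix m assume "m \<in> Poly_Mapping.keys (Poly_Mapping.single t 1 * p)"
  then show "m \<in> (+) t ` Poly_Mapping.keys p"
    by (rule keys_mult_monomials) auto
next
  fix m assume "m \<in> (+) t ` Poly_Mapping.keys p"
  then show "m \<in> Poly_Mapping.keys (Poly_Mapping.single t 1 * p)"
    by (auto simp: in_keys_iff lookup_single_times)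
qed

lemma poly_var_power: "poly_var x ^ j = Poly_Mapping.single (Poly_Mapping.single x j) (1 :: 'k::field)"
  by (induction j) (simp_all add: poly_var_def mult_single flip: single_add)

lemma split_variable:
  fixes m :: "'v \<Rightarrow>\<^sub>0 nat"
  shows "m = Poly_Mapping.single x (Poly_Mapping.lookup m x) + Poly_Mapping.update x 0 m"
  by (rule poly_mapping_eqI) (simp add: lookup_add lookup_single lookup_update when_def)

text \<open>Evaluation at the variable \<open>x\<close> identifies polynomials in \<open>X\<close> over the ring in the variables \<open>V\<close>
  with the ring in the variables \<open>insert x V\<close>.\<close>

lemma lookup_poly_eval:
  fixes q :: "('v, 'k::field) mpoly poly"
  assumes "q \<in> coeffs_in (polys_in V)" "x \<notin> V" "x \<notin> Poly_Mapping.keys m"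
  shows "Poly_Mapping.lookup (poly q (poly_var x)) (Poly_Mapping.single x j + m)
       = Poly_Mapping.lookup (coeff q j) m"
  using assms(1)
proof (induction q arbitrary: j)
  case 0
  then show ?case by simp
next
  case (pCons a q)
  have a: "a \<in> polys_in V"
    using pCons.prems unfolding coeffs_in_def by (auto dest: spec[of _ 0])
  have q: "q \<in> coeffs_in (polys_in V)"
    unfolding coeffs_in_def
  proof (intro CollectI allI)
    fix i show "coeff q i \<in> polys_in V"
      using pCons.prems unfolding coeffs_in_def by (auto dest: spec[of _ "Suc i"])
  qed
  show ?case
  proof (cases j)
    case 0
    have "m \<notin> Poly_Mapping.keys (poly_var x * poly q (poly_var x))"
      using assms(3) by (auto simp: poly_var_def keys_single_times keys_add_nat)
    then show ?thesis using 0 by (simp add: lookup_add in_keys_iff)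
  next
    case (Suc i)
    have s: "Poly_Mapping.single x j + m
        = Poly_Mapping.single x 1 + (Poly_Mapping.single x i + m)"
      unfolding Suc add.assoc[symmetric] single_add[symmetric] by simp
    have "x \<in> Poly_Mapping.keys (Poly_Mapping.single x j + m)"
      by (simp add: Suc keys_add_nat)
    then have "Poly_Mapping.single x j + m \<notin> Poly_Mapping.keys a"
      using a assms(2) unfolding polys_in_def by blast
    then have "Poly_Mapping.lookup a (Poly_Mapping.single x j + m) = 0"
      by (simp add: in_keys_iff)
    moreover have "Poly_Mapping.lookup (poly_var x * poly q (poly_var x)) (Poly_Mapping.single x j + m)
        = Poly_Mapping.lookup (coeff q i) m"
      unfolding s poly_var_def lookup_single_times using pCons.IH[OF q, of i]
      by (simp add: poly_var_def)
    ultimately show ?thesis by (simp add: lookup_add Suc)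
  qed
qed

lemma poly_eval_mem:
  fixes q :: "('v, 'k::field) mpoly poly"
  assumes q: "q \<in> coeffs_in (polys_in V)" and x: "x \<notin> V"
  shows "poly q (poly_var x) \<in> polys_in (insert x V)"
  unfolding polys_in_def
proof (intro CollectI ballI)
  fix m assume m: "m \<in> Poly_Mapping.keys (poly q (poly_var x))"
  define j where "j = Poly_Mapping.lookup m x"
  define m0 where "m0 = Poly_Mapping.update x 0 m"
  have "x \<notin> Poly_Mapping.keys m0" and ms: "m = Poly_Mapping.single x j + m0"
    using split_variable[of m x] by (simp_all add: m0_def j_def keys_update)
  then have "m0 \<in> Poly_Mapping.keys (coeff q j)"
    using m lookup_poly_eval[OF q x, of m0 j] by (simp add: in_keys_iff)
  then show "Poly_Mapping.keys m \<subseteq> insert x V"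
    using q by (auto simp: ms keys_add_nat coeffs_in_def polys_in_def split: if_splits)
qed

lemma poly_eval_onto:
  fixes b :: "('v, 'k::field) mpoly"
  assumes b: "b \<in> polys_in (insert x V)"
  shows "\<exists>q\<in>coeffs_in (polys_in V). poly q (poly_var x) = b"
proof
  let ?r = "\<lambda>m. Poly_Mapping.single (Poly_Mapping.update x 0 m) (Poly_Mapping.lookup b m)"
  let ?q = "\<Sum>m\<in>Poly_Mapping.keys b. monom (?r m) (Poly_Mapping.lookup m x)"
  have dV: "diff_closed (polys_in V :: ('v, 'k) mpoly set)"
    using subring_set_polys_in by (auto simp: subring_set_def)
  show "?q \<in> coeffs_in (polys_in V)"
  proof (rule diff_closed_sum[OF diff_closed_coeffs_in[OF dV]])
    fix m assume "m \<in> Poly_Mapping.keys b"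
    then have "Poly_Mapping.keys (Poly_Mapping.update x 0 m) \<subseteq> V"
      using b by (auto simp: keys_update polys_in_def)
    then have "?r m \<in> polys_in V" by (simp add: polys_in_def)
    then show "monom (?r m) (Poly_Mapping.lookup m x) \<in> coeffs_in (polys_in V)"
      using diff_closedD(1)[OF dV] by (simp add: coeffs_in_def)
  qed
  have "?r m * poly_var x ^ Poly_Mapping.lookup m x = Poly_Mapping.single m (Poly_Mapping.lookup b m)" for m
    using split_variable[of m x] by (simp add: poly_var_power mult_single add.commute)
  then show "poly ?q (poly_var x) = b"
    using sum_monomials[of b] by (simp add: poly_sum poly_monom)
qed

text \<open>When \<open>\<Delta>\<close> is a cone with apex \<open>x\<close>, its nonface ideal is extended from the ring without \<open>x\<close>.\<close>

lemma poly_eval_mem_nonface_ideal_iff: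
  fixes q :: "('v, 'k::field) mpoly poly"
  assumes q: "q \<in> coeffs_in (polys_in V)" and x: "x \<notin> V"
    and \<Delta>: "down_closed \<Delta>" and cone: "\<And>F. F \<in> \<Delta> \<Longrightarrow> insert x F \<in> \<Delta>"
  shows "poly q (poly_var x) \<in> nonface_ideal (insert x V) \<Delta> \<longleftrightarrow> q \<in> coeffs_in (nonface_ideal V \<Delta>)"
proof
  assume p: "poly q (poly_var x) \<in> nonface_ideal (insert x V) \<Delta>"
  have "Poly_Mapping.keys m \<notin> \<Delta>" if m: "m \<in> Poly_Mapping.keys (coeff q j)" for j m
  proof
    assume "Poly_Mapping.keys m \<in> \<Delta>"
    then have "insert x (Poly_Mapping.keys m) \<in> \<Delta>" by (rule cone)
    moreover have "Poly_Mapping.keys (Poly_Mapping.single x j + m) \<subseteq> insert x (Poly_Mapping.keys m)"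
      by (auto simp: keys_add_nat)
    ultimately have "Poly_Mapping.keys (Poly_Mapping.single x j + m) \<in> \<Delta>"
      using \<Delta> unfolding down_closed_def by blast
    moreover have "x \<notin> Poly_Mapping.keys m"
      using q x m by (auto simp: coeffs_in_def polys_in_def)
    then have "Poly_Mapping.single x j + m \<in> Poly_Mapping.keys (poly q (poly_var x))"
      using m lookup_poly_eval[OF q x, of m j] by (simp add: in_keys_iff)
    ultimately show False using p by (auto simp: nonface_ideal_def)
  qed
  then show "q \<in> coeffs_in (nonface_ideal V \<Delta>)"
    using q by (auto simp: coeffs_in_def nonface_ideal_def)
next
  assume n: "q \<in> coeffs_in (nonface_ideal V \<Delta>)"
  have "Poly_Mapping.keys m \<notin> \<Delta>" if m: "m \<in> Poly_Mapping.keys (poly q (poly_var x))" for m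
  proof -
    define j where "j = Poly_Mapping.lookup m x"
    define m0 where "m0 = Poly_Mapping.update x 0 m"
    have "x \<notin> Poly_Mapping.keys m0" and ms: "m = Poly_Mapping.single x j + m0"
      using split_variable[of m x] by (simp_all add: m0_def j_def keys_update)
    then have "m0 \<in> Poly_Mapping.keys (coeff q j)"
      using m lookup_poly_eval[OF q x, of m0 j] by (simp add: in_keys_iff)
    then have "Poly_Mapping.keys m0 \<notin> \<Delta>"
      using n by (auto simp: coeffs_in_def nonface_ideal_def)
    then show ?thesis using \<Delta> by (auto simp: ms keys_add_nat down_closed_def)
  qed
  then show "poly q (poly_var x) \<in> nonface_ideal (insert x V) \<Delta>"
    using poly_eval_mem[OF q x] by (simp add: nonface_ideal_def)
qed

lemma poly_var_mem: "x \<in> V \<Longrightarrow> poly_var x \<in> polys_in V"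
  by (simp add: poly_var_def polys_in_def)

lemma polys_in_insertI: "p \<in> polys_in V \<Longrightarrow> p \<in> polys_in (insert x V)"
  by (auto simp: polys_in_def)

section \<open>Complete homogeneous symmetric polynomials\<close>

text \<open>The sum of all monomials of degree \<open>i\<close> in the listed variables, by the recursion on whether
  the first variable divides the monomial.\<close>

fun complete_homogeneous :: "'v list \<Rightarrow> nat \<Rightarrow> ('v, 'k::field) mpoly" where
  "complete_homogeneous xs 0 = 1"
| "complete_homogeneous [] (Suc i) = 0"
| "complete_homogeneous (x # xs) (Suc i) =
     complete_homogeneous xs (Suc i) + poly_var x * complete_homogeneous (x # xs) i"

lemma complete_homogeneous_mem: "(complete_homogeneous xs i :: ('v, 'k::field) mpoly) \<in> polys_in (set xs)"
proof (induction xs i rule: complete_homogeneous.induct)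
  case (3 x xs i)
  let ?P = "polys_in (insert x (set xs)) :: ('v, 'k) mpoly set"
  have R: "subring_set ?P" by (rule subring_set_polys_in)
  then have d: "diff_closed ?P" by (simp add: subring_set_def)
  have "poly_var x * complete_homogeneous (x # xs) i \<in> ?P"
    using 3(2) R poly_var_mem[of x "insert x (set xs)"] by (auto simp: subring_set_def)
  with polys_in_insertI[OF 3(1)] show ?case
    by (simp add: diff_closedD(4)[OF d])
qed (simp_all add: polys_in_def)

text \<open>The same polynomial for \<open>x # xs\<close>, expanded in powers of \<open>x\<close>. It is monic of degree \<open>i\<close>.\<close>

primrec complete_homogeneous_poly :: "'v list \<Rightarrow> nat \<Rightarrow> ('v, 'k::field) mpoly poly" where
  "complete_homogeneous_poly xs 0 = 1"
| "complete_homogeneous_poly xs (Suc i) =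
     pCons (complete_homogeneous xs (Suc i)) (complete_homogeneous_poly xs i)"

lemma poly_complete_homogeneous_poly:
  "poly (complete_homogeneous_poly xs i) (poly_var x) = complete_homogeneous (x # xs) i"
  by (induction i) simp_all

lemma coeff_complete_homogeneous_poly:
  "coeff (complete_homogeneous_poly xs s) i
     = (if i \<le> s then complete_homogeneous xs (s - i) else 0)"
  by (induction s arbitrary: i) (auto simp: coeff_pCons coeff_1 split: nat.split)

text \<open>Over a cone with apex \<open>x\<close> the quotient is a polynomial ring in \<open>x\<close> over the quotient for \<open>ys\<close>. The
  first element is monic in \<open>x\<close>, and modulo it the others become the complete homogeneous
  polynomials in \<open>ys\<close>. The index thereby rises by one while the length drops by one, which is why
  the starting degree \<open>s\<close> is arbitrary.\<close>

lemma regular_mod_cone: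
  fixes \<Delta> :: "'v set set"
  assumes x: "x \<notin> set ys" and \<Delta>: "down_closed \<Delta>"
    and cone: "\<And>F. F \<in> \<Delta> \<Longrightarrow> insert x F \<in> \<Delta>"
    and reg: "regular_mod (polys_in (set ys)) (nonface_ideal (set ys) \<Delta> :: ('v, 'k::field) mpoly set)
      (map (complete_homogeneous ys) [Suc s..<Suc s + e])"
  shows "regular_mod (polys_in (set (x # ys))) (nonface_ideal (set (x # ys)) \<Delta> :: ('v, 'k) mpoly set)
      (map (complete_homogeneous (x # ys)) [s..<s + Suc e])"
proof -
  let ?A = "polys_in (set ys) :: ('v, 'k) mpoly set" and ?B = "polys_in (set (x # ys)) :: ('v, 'k) mpoly set"
  let ?NA = "nonface_ideal (set ys) \<Delta> :: ('v, 'k) mpoly set"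
  let ?N = "nonface_ideal (set (x # ys)) \<Delta> :: ('v, 'k) mpoly set"
  let ?h = "complete_homogeneous (x # ys) :: nat \<Rightarrow> ('v, 'k) mpoly"
  let ?gs = "map (complete_homogeneous ys) [Suc s..<Suc s + e] :: ('v, 'k) mpoly list"
  let ?p = "complete_homogeneous_poly ys s :: ('v, 'k) mpoly poly"
  have A: "subring_set ?A" and B: "subring_set ?B" by (rule subring_set_polys_in)+
  have NA: "ideal_set ?A ?NA" and N: "ideal_set ?B ?N"
    by (rule ideal_set_nonface_ideal[OF \<Delta>])+
  have dA: "diff_closed ?A" and dN: "diff_closed ?N" and dB: "diff_closed ?B"
    using A B N by (auto simp: subring_set_def ideal_set_def)
  have hA: "complete_homogeneous ys i \<in> ?A" for i by (rule complete_homogeneous_mem)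
  have hB: "?h i \<in> ?B" for i by (rule complete_homogeneous_mem)
  have gB: "complete_homogeneous ys i \<in> ?B" for i
    using hA by (simp add: polys_in_insertI)
  have pC: "?p \<in> coeffs_in ?A"
    using hA diff_closedD(1)[OF dA] by (simp add: coeffs_in_def coeff_complete_homogeneous_poly)
  have gC: "set (?p # map (\<lambda>g. [:g:]) ?gs) \<subseteq> coeffs_in ?A"
    using hA pC diff_closedD(1)[OF dA]
    by (auto simp: coeffs_in_def coeff_pCons split: nat.split)
  have "regular_mod (coeffs_in ?A) (coeffs_in ?NA) (?p # map (\<lambda>g. [:g:]) ?gs)"
    by (rule regular_mod_monic[OF A NA pC, where s = s])
      (use hA reg in \<open>auto simp: coeff_complete_homogeneous_poly simp del: upt_Suc\<close>)
  then have "regular_mod ?B ?N (?h s # ?gs)"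
  proof (rule regular_mod_transfer[where \<phi> = "\<lambda>q. poly q (poly_var x)"])
    show "stable_pair (?p # map (\<lambda>g. [:g:]) ?gs) (coeffs_in ?A) (coeffs_in ?NA)"
      by (rule stable_pairI[OF subring_set_coeffs_in[OF A] ideal_set_coeffs_in[OF NA] gC])
    show "stable_pair (?h s # ?gs) ?B ?N"
      by (rule stable_pairI[OF B N]) (use hB gB in auto)
    show "poly q (poly_var x) \<in> ?B" if "q \<in> coeffs_in ?A" for q
      using poly_eval_mem[OF that x] by simp
    show "poly q (poly_var x) \<in> ?N \<longleftrightarrow> q \<in> coeffs_in ?NA" if "q \<in> coeffs_in ?A" for q
      using poly_eval_mem_nonface_ideal_iff[OF that x \<Delta> cone] by simp
    show "\<exists>q\<in>coeffs_in ?A. b - poly q (poly_var x) \<in> ?N" if b: "b \<in> ?B" for b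
    proof -
      obtain q where "q \<in> coeffs_in ?A" "poly q (poly_var x) = b"
        using poly_eval_onto[of b x "set ys"] b by auto
      then show ?thesis using diff_closedD(1)[OF dN] by (intro bexI[of _ q]) simp_all
    qed
    show "list_all2 (\<lambda>f f'. \<forall>b\<in>coeffs_in ?A. poly (f * b) (poly_var x) - f' * poly b (poly_var x) \<in> ?N)
        (?p # map (\<lambda>g. [:g:]) ?gs) (?h s # ?gs)"
      using diff_closedD(1)[OF dN]
      by (simp add: poly_complete_homogeneous_poly list_all2_map1 list_all2_map2 list.rel_refl del: upt_Suc)
  qed simp
  then have head: "\<forall>b\<in>?B. ?h s * b \<in> ?N \<longrightarrow> b \<in> ?N"
    and tail: "regular_mod ?B (enlarge ?N (?h s) ?B) ?gs" by simp_all
  have "regular_mod ?B (enlarge ?N (?h s) ?B) (map ?h [Suc s..<Suc s + e])"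
  proof (rule regular_mod_shift[OF B _ hB _ _ _ tail])
    show "poly_var x \<in> ?B" by (simp add: poly_var_mem)
    show "ideal_set ?B (enlarge ?N (?h s) ?B)" by (rule ideal_set_enlarge[OF B N hB])
    show "?h s \<in> enlarge ?N (?h s) ?B"
      using mult_mem_enlarge[OF dN, of 1 ?B "?h s"] B by (simp add: subring_set_def)
  qed simp
  moreover have "[s..<s + Suc e] = s # [Suc s..<Suc s + e]"
    by (simp add: upt_conv_Cons)
  ultimately show ?thesis using head by simp
qed

text \<open>The colon ideal by \<open>x\<close>: it belongs to a complex that is a cone with apex \<open>x\<close>.\<close>

lemma var_mult_mem_nonface_ideal_iff:
  fixes b :: "('v, 'k::field) mpoly"
  assumes "b \<in> polys_in V" "x \<in> V"
  shows "poly_var x * b \<in> nonface_ideal V \<Delta> \<longleftrightarrow> b \<in> nonface_ideal V {F. insert x F \<in> \<Delta>}"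
proof -
  have "poly_var x * b \<in> polys_in V"
    using assms subring_set_polys_in[of V] poly_var_mem[of x V] by (auto simp: subring_set_def)
  moreover have "Poly_Mapping.keys (poly_var x * b) = (+) (Poly_Mapping.single x 1) ` Poly_Mapping.keys b"
    by (simp add: poly_var_def keys_single_times)
  ultimately show ?thesis
    using assms(1) by (auto simp: nonface_ideal_def keys_add_nat)
qed

text \<open>Dividing by \<open>x\<close> as well restricts the complex to the remaining vertices.\<close>

lemma mem_enlarge_var_iff:
  fixes b :: "('v, 'k::field) mpoly"
  assumes b: "b \<in> polys_in V" and x: "x \<notin> V"
  shows "b \<in> enlarge (nonface_ideal (insert x V) \<Delta>) (poly_var x) (polys_in (insert x V))
     \<longleftrightarrow> b \<in> nonface_ideal V \<Delta>" (is "b \<in> ?L \<longleftrightarrow> _")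
proof
  assume "b \<in> ?L"
  then obtain n c where nc: "b = n + poly_var x * c" "n \<in> nonface_ideal (insert x V) \<Delta>"
    by (auto simp: enlarge_def)
  have "Poly_Mapping.keys m \<notin> \<Delta>" if m: "m \<in> Poly_Mapping.keys b" for m
  proof -
    have "x \<notin> Poly_Mapping.keys m" using m b x by (auto simp: polys_in_def)
    then have "m \<notin> Poly_Mapping.keys (poly_var x * c)"
      by (auto simp: poly_var_def keys_single_times keys_add_nat)
    then have "m \<in> Poly_Mapping.keys n"
      using m keys_add[of n "poly_var x * c"] nc(1) by auto
    then show ?thesis using nc(2) by (simp add: nonface_ideal_def)
  qed
  then show "b \<in> nonface_ideal V \<Delta>" using b by (simp add: nonface_ideal_def)
next
  assume "b \<in> nonface_ideal V \<Delta>"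
  then have "b \<in> nonface_ideal (insert x V) \<Delta>"
    by (simp add: nonface_ideal_def polys_in_insertI)
  moreover have "diff_closed (polys_in (insert x V) :: ('v, 'k) mpoly set)"
    using subring_set_polys_in by (auto simp: subring_set_def)
  ultimately show "b \<in> ?L" using subset_enlarge by blast
qed

text \<open>If all sets of at most \<open>d\<close> vertices are faces, any \<open>d\<close> consecutive complete homogeneous polynomials
  form a regular sequence. Multiplication by the first variable \<open>x\<close> gives an exact sequence
  \<open>0 \<rightarrow> R/(I : x) \<rightarrow> R/I \<rightarrow> R/(I + (x)) \<rightarrow> 0\<close>. On the right one variable less is left and the
  polynomials restrict to those in the other variables. On the left there is a cone, handled by
  the case of \<open>d - 1\<close> polynomials in the other variables. If there are exactly \<open>d\<close>
  variables, every set of them is a face, so \<open>I = 0\<close> and the cone case alone suffices.\<close>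

theorem regular_mod_complete_homogeneous:
  fixes \<Delta> :: "'v set set"
  assumes "distinct xs" "down_closed \<Delta>" "d \<le> length xs"
    and "\<And>F. F \<subseteq> set xs \<Longrightarrow> card F \<le> d \<Longrightarrow> F \<in> \<Delta>"
  shows "regular_mod (polys_in (set xs)) (nonface_ideal (set xs) \<Delta> :: ('v, 'k::field) mpoly set)
    (map (complete_homogeneous xs) [s..<s + d])"
  using assms
proof (induction xs arbitrary: d s \<Delta>)
  case Nil
  then show ?case by simp
next
  case (Cons x ys)
  note \<Delta> = Cons.prems(2)
  have x: "x \<notin> set ys" and ys: "distinct ys" using Cons.prems(1) by auto
  show ?case
  proof (cases d)
    case 0
    then show ?thesis by simp
  next
    case (Suc e)
    have cone: "regular_mod (polys_in (set (x # ys))) (nonface_ideal (set (x # ys)) \<Gamma> :: ('v, 'k) mpoly set)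
        (map (complete_homogeneous (x # ys)) [s..<s + Suc e])"
      if \<Gamma>: "down_closed \<Gamma>" "\<And>F. F \<in> \<Gamma> \<Longrightarrow> insert x F \<in> \<Gamma>"
        "\<And>F. F \<subseteq> set ys \<Longrightarrow> card F \<le> e \<Longrightarrow> F \<in> \<Gamma>" for \<Gamma>
      by (rule regular_mod_cone[OF x \<Gamma>(1,2)], assumption, rule Cons.IH[OF ys \<Gamma>(1)])
        (use Cons.prems(3) Suc \<Gamma>(3) in auto)
    show ?thesis
    proof (cases "d \<le> length ys")
      case False
      have "F \<in> \<Delta>" if "F \<subseteq> set (x # ys)" for F
      proof -
        have "card F \<le> length (x # ys)"
          using card_mono[OF _ that] card_length[of "x # ys"] by (meson List.finite_set le_trans)
        then show ?thesis using Cons.prems(4)[OF that] False by simp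
      qed
      then have "nonface_ideal (set (x # ys)) \<Delta> = (nonface_ideal (set (x # ys)) UNIV :: ('v, 'k) mpoly set)"
        unfolding nonface_ideal_def polys_in_def by blast
      then show ?thesis using cone[of UNIV] Suc by (simp add: down_closed_def)
    next
      case True
      let ?A = "polys_in (set ys) :: ('v, 'k) mpoly set" and ?B = "polys_in (set (x # ys)) :: ('v, 'k) mpoly set"
      let ?N = "nonface_ideal (set (x # ys)) \<Delta> :: ('v, 'k) mpoly set"
      let ?X = "poly_var x :: ('v, 'k) mpoly"
      let ?L = "enlarge ?N ?X ?B"
      let ?hs = "map (complete_homogeneous (x # ys)) [s..<s + d] :: ('v, 'k) mpoly list"
      let ?\<Gamma> = "{F. insert x F \<in> \<Delta>}"
      have A: "subring_set ?A" and B: "subring_set ?B" by (rule subring_set_polys_in)+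
      have N: "ideal_set ?B ?N" by (rule ideal_set_nonface_ideal[OF \<Delta>])
      have X: "?X \<in> ?B" by (simp add: poly_var_mem)
      have L: "ideal_set ?B ?L" by (rule ideal_set_enlarge[OF B N X])
      have dN: "diff_closed ?N" and dL: "diff_closed ?L" using N L by (auto simp: ideal_set_def)
      have dB: "diff_closed ?B" using B by (auto simp: subring_set_def)
      have hB: "set ?hs \<subseteq> ?B" using complete_homogeneous_mem[of "x # ys"] by auto
      have spN: "stable_pair ?hs ?B ?N" by (rule stable_pairI[OF B N hB])
      have spL: "stable_pair ?hs ?B ?L" by (rule stable_pairI[OF B L hB])
      have spLN: "stable_pair ?hs ?L ?N"
        using spN spL subset_enlarge[OF dB] by (simp add: stable_pair_def)
      have \<Gamma>: "down_closed ?\<Gamma>"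
        using \<Delta> unfolding down_closed_def by (auto intro: insert_mono)
      have cardins: "F \<in> ?\<Gamma>" if "F \<subseteq> set ys" "card F \<le> e" for F
      proof -
        have "card (insert x F) \<le> Suc (card F)" by (rule card_insert_le_m1[THEN order_trans]) auto
        then show ?thesis using Cons.prems(4)[of "insert x F"] that Suc by auto
      qed
      have "regular_mod ?B ?L ?hs"
      proof (rule regular_mod_transfer[where \<phi> = "\<lambda>b. b" and fs = "map (complete_homogeneous ys) [s..<s + d]"])
        show "regular_mod ?A (nonface_ideal (set ys) \<Delta>) (map (complete_homogeneous ys) [s..<s + d])"
          by (rule Cons.IH[OF ys \<Delta> True]) (use Cons.prems(4) in auto)
        show "stable_pair (map (complete_homogeneous ys) [s..<s + d]) ?A (nonface_ideal (set ys) \<Delta>)"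
          by (rule stable_pairI[OF A ideal_set_nonface_ideal[OF \<Delta>]]) (use complete_homogeneous_mem in auto)
        show "b \<in> ?B" if "b \<in> ?A" for b
          using that by (simp add: polys_in_insertI)
        show "b \<in> ?L \<longleftrightarrow> b \<in> nonface_ideal (set ys) \<Delta>" if "b \<in> ?A" for b
          using mem_enlarge_var_iff[OF that x] by simp
        show "\<exists>a\<in>?A. b - a \<in> ?L" if b: "b \<in> ?B" for b
        proof -
          obtain q where q: "q \<in> coeffs_in ?A" "poly q ?X = b"
            using poly_eval_onto[of b x "set ys"] b by auto
          obtain a r where ar: "q = pCons a r" by (cases q)
          have "a \<in> ?A" using q(1) unfolding coeffs_in_def ar by (auto dest: spec[of _ 0])
          moreover have "r \<in> coeffs_in ?A"
            unfolding coeffs_in_def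
          proof (intro CollectI allI)
            fix i show "coeff r i \<in> ?A"
              using q(1) unfolding coeffs_in_def ar by (auto dest: spec[of _ "Suc i"])
          qed
          then have "poly r ?X \<in> ?B" using poly_eval_mem[OF _ x] by simp
          then have "b - a \<in> ?L" using mult_mem_enlarge[OF dN] q(2) ar by auto
          ultimately show ?thesis by blast
        qed
        have "complete_homogeneous ys i * b - complete_homogeneous (x # ys) i * b \<in> ?L"
          if b: "b \<in> ?A" for b i
        proof (cases i)
          case 0
          then show ?thesis using diff_closedD(1)[OF dL] by simp
        next
          case (Suc j)
          have "complete_homogeneous (x # ys) j \<in> ?B" by (rule complete_homogeneous_mem)
          then have "- (complete_homogeneous (x # ys) j * b) \<in> ?B"
            using B polys_in_insertI[OF b]
            by (intro diff_closedD(3)[OF dB]) (simp add: subring_set_def)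
          from mult_mem_enlarge[OF dN this, of ?X] show ?thesis
            using Suc by (simp add: algebra_simps)
        qed
        then show "list_all2 (\<lambda>f f'. \<forall>b\<in>?A. f * b - f' * b \<in> ?L)
            (map (complete_homogeneous ys) [s..<s + d]) ?hs"
          by (simp add: list_all2_conv_all_nth)
      qed (use spL in simp_all)
      moreover have "regular_mod ?L ?N ?hs"
      proof (rule regular_mod_transfer[where \<phi> = "\<lambda>b. ?X * b"])
        show "regular_mod ?B (nonface_ideal (set (x # ys)) ?\<Gamma>) ?hs"
          unfolding Suc using \<Gamma> cardins by (intro cone) auto
        show "stable_pair ?hs ?B (nonface_ideal (set (x # ys)) ?\<Gamma>)"
          by (rule stable_pairI[OF B ideal_set_nonface_ideal[OF \<Gamma>] hB])
        show "?X * b \<in> ?L" if "b \<in> ?B" for b by (rule mult_mem_enlarge[OF dN that])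
        show "?X * b \<in> ?N \<longleftrightarrow> b \<in> nonface_ideal (set (x # ys)) ?\<Gamma>" if "b \<in> ?B" for b
          using that by (rule var_mult_mem_nonface_ideal_iff) simp
        show "\<exists>b\<in>?B. l - ?X * b \<in> ?N" if "l \<in> ?L" for l
        proof -
          from that obtain n b where "l = n + ?X * b" "n \<in> ?N" "b \<in> ?B" by (auto simp: enlarge_def)
          then show ?thesis by (intro bexI[of _ b]) simp_all
        qed
        show "list_all2 (\<lambda>f f'. \<forall>b\<in>?B. ?X * (f * b) - f' * (?X * b) \<in> ?N) ?hs ?hs"
          using diff_closedD(1)[OF dN] by (simp add: list_all2_conv_all_nth mult.left_commute)
      qed (use spLN in \<open>simp_all add: algebra_simps\<close>)
      ultimately show ?thesis
        by (intro regular_mod_extension[OF spN spL spLN])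
    qed
  qed
qed

section \<open>A nonzero Koszul class from a facet\<close>

definition squarefree_exponent :: "'v set \<Rightarrow> 'v \<Rightarrow>\<^sub>0 nat" where
  "squarefree_exponent S = (\<Sum>u\<in>S. Poly_Mapping.single u 1)"

lemma keys_squarefree_exponent: "finite S \<Longrightarrow> Poly_Mapping.keys (squarefree_exponent S) = S"
  unfolding squarefree_exponent_def
  by (induction S rule: finite_induct) (simp_all add: keys_add_nat)

lemma squarefree_exponent_insert:
  "finite S \<Longrightarrow> u \<notin> S \<Longrightarrow>
     squarefree_exponent (insert u S) = Poly_Mapping.single u 1 + squarefree_exponent S"
  by (simp add: squarefree_exponent_def)

lemma prod_poly_var:
  "finite S \<Longrightarrow> (\<Prod>u\<in>S. poly_var u) = (Poly_Mapping.single (squarefree_exponent S) 1 :: ('v, 'k::field) mpoly)"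
  by (induction S rule: finite_induct)
    (simp_all add: squarefree_exponent_insert poly_var_def mult_single squarefree_exponent_def[of "{}"])

lemma lookup_koszul_sign_mult:
  fixes p :: "('v, 'k::field) mpoly"
  shows "Poly_Mapping.lookup (koszul_sign k S * p) m = koszul_sign k S * Poly_Mapping.lookup p m"
  by (cases "even (card {j\<in>S. j < k})") (simp_all add: koszul_sign_def)

text \<open>The product of the variables in a facet \<open>F\<close> with \<open>d\<close> elements, placed at the subset \<open>F\<close>, is a
  cocycle because multiplying by any further variable leaves the complex. If it were a
  coboundary modulo the ideal, then comparing at each \<open>S\<close> of size \<open>d\<close> the coefficient of the
  squarefree monomial on \<open>S\<close>, which no element of the ideal contains, would make the indicator
  function of \<open>F\<close> a coboundary over the field. Its own coboundary at \<open>insert w F\<close> is a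
  sign and hence nonzero, contradicting \<open>koszul_diff_diff\<close>. Topologically: the full skeleton contains the
  boundary of the simplex on \<open>insert w F\<close>, a cycle that passes once through the facet \<open>F\<close>.\<close>

lemma not_koszul_exact_facet:
  fixes v :: "'i::linorder \<Rightarrow> 'v" and \<Delta> :: "'v set set"
  assumes K: "finite K" and inj: "inj_on v K" and \<Delta>: "down_closed \<Delta>"
    and skel: "\<And>S. S \<subseteq> v ` K \<Longrightarrow> card S \<le> d \<Longrightarrow> S \<in> \<Delta>"
    and F: "F \<subseteq> K" "card F = d" and w: "w \<in> K - F"
    and facet: "\<And>k. k \<in> K - F \<Longrightarrow> insert (v k) (v ` F) \<notin> \<Delta>"
  shows "\<not> koszul_exact K (\<lambda>k. poly_var (v k)) (polys_in (v ` K))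
           (nonface_ideal (v ` K) \<Delta> :: ('v, 'k::field) mpoly set) d"
proof
  let ?x = "\<lambda>k. poly_var (v k) :: ('v, 'k) mpoly"
  let ?B = "polys_in (v ` K) :: ('v, 'k) mpoly set" and ?N = "nonface_ideal (v ` K) \<Delta> :: ('v, 'k) mpoly set"
  let ?e = "\<lambda>S. squarefree_exponent (v ` S)"
  assume exact: "koszul_exact K ?x ?B ?N d"
  have B: "subring_set ?B" by (rule subring_set_polys_in)
  have N: "ideal_set ?B ?N" by (rule ideal_set_nonface_ideal[OF \<Delta>])
  have dN: "diff_closed ?N" and dB: "diff_closed ?B" using N B by (auto simp: ideal_set_def subring_set_def)
  have fin: "finite S" if "S \<subseteq> K" for S using that K by (rule finite_subset)
  define c where "c S = (if S = F then Poly_Mapping.single (?e F) 1 else 0 :: ('v, 'k) mpoly)" for S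
  have cB: "\<forall>S. c S \<in> ?B"
    using F(1) fin[OF F(1)] diff_closedD(1)[OF dB]
    by (auto simp: c_def polys_in_def keys_squarefree_exponent)
  have "koszul_diff ?x c S \<in> ?N" if S: "S \<subseteq> K" "card S = Suc d" for S
    unfolding koszul_diff_def
  proof (rule diff_closed_sum[OF dN])
    fix k assume k: "k \<in> S"
    have "?x k * c (S - {k}) \<in> ?N"
    proof (cases "S - {k} = F")
      case True
      then have kF: "k \<in> K - F" using k S(1) by auto
      have "?x k * c (S - {k}) = Poly_Mapping.single (Poly_Mapping.single (v k) 1 + ?e F) 1"
        by (simp add: c_def True poly_var_def mult_single)
      then show ?thesis
        using facet[OF kF] kF F(1) fin[OF F(1)]
        by (auto simp: nonface_ideal_def polys_in_def keys_add_nat keys_squarefree_exponent)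
    qed (use diff_closedD(1)[OF dN] in \<open>simp add: c_def\<close>)
    then show "koszul_sign k S * ?x k * c (S - {k}) \<in> ?N"
      using koszul_sign_mem[OF B, of k S] N by (simp add: ideal_set_def mult.assoc)
  qed
  with exact cB obtain b where b: "\<And>S. S \<subseteq> K \<Longrightarrow> card S = d \<Longrightarrow> c S - koszul_diff ?x b S \<in> ?N"
    unfolding koszul_exact_def by blast
  define \<beta> where "\<beta> S = Poly_Mapping.lookup (b S) (?e S)" for S
  have \<beta>: "koszul_diff (\<lambda>_. 1) \<beta> S = (if S = F then 1 else 0)" if S: "S \<subseteq> K" "card S = d" for S
  proof -
    have "v ` S \<in> \<Delta>"
      using S card_image_le[OF fin[OF S(1)], of v] by (intro skel) auto
    then have "?e S \<notin> Poly_Mapping.keys (c S - koszul_diff ?x b S)"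
      using b[OF S] fin[OF S(1)] by (auto simp: nonface_ideal_def keys_squarefree_exponent)
    then have "Poly_Mapping.lookup (koszul_diff ?x b S) (?e S) = Poly_Mapping.lookup (c S) (?e S)"
      by (simp add: in_keys_iff lookup_minus)
    moreover have "Poly_Mapping.lookup (koszul_diff ?x b S) (?e S) = koszul_diff (\<lambda>_. 1) \<beta> S"
      unfolding koszul_diff_def lookup_sum
    proof (rule sum.cong[OF refl])
      fix k assume k: "k \<in> S"
      have "v k \<notin> v ` (S - {k})" using inj k S(1) by (auto simp: inj_on_def)
      moreover have "v ` S = insert (v k) (v ` (S - {k}))" using k by auto
      ultimately have "?e S = Poly_Mapping.single (v k) 1 + ?e (S - {k})"
        using fin[OF S(1)] by (simp add: squarefree_exponent_insert)
      then have "Poly_Mapping.lookup (?x k * b (S - {k})) (?e S) = \<beta> (S - {k})"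
        by (simp add: poly_var_def lookup_single_times \<beta>_def)
      then show "Poly_Mapping.lookup (koszul_sign k S * ?x k * b (S - {k})) (?e S)
          = koszul_sign k S * 1 * \<beta> (S - {k})"
        by (simp add: mult.assoc lookup_koszul_sign_mult)
    qed
    ultimately show ?thesis by (simp add: c_def)
  qed
  let ?G = "insert w F"
  have fF: "finite F" by (rule fin[OF F(1)])
  have "koszul_diff (\<lambda>_. 1) (koszul_diff (\<lambda>_. 1) \<beta>) ?G
      = (\<Sum>k\<in>?G. if k = w then koszul_sign k ?G else 0)"
    unfolding koszul_diff_def[of _ "koszul_diff (\<lambda>_. 1) \<beta>"]
  proof (rule sum.cong[OF refl])
    fix k assume k: "k \<in> ?G"
    have "card (?G - {k}) = d" using k w F fF by (simp add: card_Diff_singleton)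
    moreover have "?G - {k} \<subseteq> K" using w F(1) by auto
    moreover have "?G - {k} = F \<longleftrightarrow> k = w" using k w by auto
    ultimately show "koszul_sign k ?G * 1 * koszul_diff (\<lambda>_. 1) \<beta> (?G - {k})
        = (if k = w then koszul_sign k ?G else 0)"
      using \<beta>[of "?G - {k}"] by simp
  qed
  also have "\<dots> = koszul_sign w ?G" using fF by simp
  finally have "koszul_sign w ?G = (0 :: 'k)"
    using koszul_diff_diff[of ?G "\<lambda>_. 1 :: 'k" \<beta>] fF by simp
  then show False
    using koszul_sign_mult_self[of w ?G, where ?'a = 'k] by simp
qed

section \<open>Squarefree powers and quotient modules\<close>

lemma carrier_poly_ring: "carrier (poly_ring V) = polys_in V"
  by (simp add: poly_ring_def polys_in_def)

lemma poly_ring_ring: "ring (poly_ring V :: ('v, 'k::field) mpoly ring)"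
  by (rule cring.axioms(1)[OF poly_ring_cring])

lemma poly_ring_ops:
  "a \<otimes>\<^bsub>poly_ring V\<^esub> b = a * b" "\<one>\<^bsub>poly_ring V\<^esub> = 1"
  "\<zero>\<^bsub>poly_ring V\<^esub> = 0" "a \<oplus>\<^bsub>poly_ring V\<^esub> b = a + b"
  by (simp_all add: poly_ring_def)

lemma minus_poly_ring:
  fixes a b :: "('v, 'k::field) mpoly"
  assumes "a \<in> polys_in V"
  shows "a_inv (poly_ring V) a = - a"
proof -
  interpret ring "poly_ring V :: ('v, 'k) mpoly ring" by (rule poly_ring_ring)
  have "- a \<in> polys_in V"
    using assms subring_set_polys_in[of V] diff_closedD(3) unfolding subring_set_def by blast
  then show ?thesis
    using assms by (intro minus_equality) (simp_all add: carrier_poly_ring poly_ring_ops)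
qed

lemma ideal_poly_ring_iff:
  fixes J :: "('v, 'k::field) mpoly set"
  shows "ideal J (poly_ring V) \<longleftrightarrow> ideal_set (polys_in V) J"
proof
  assume J: "ideal_set (polys_in V) J"
  have d: "diff_closed J" and sub: "J \<subseteq> polys_in V" using J by (auto simp: ideal_set_def)
  show "ideal J (poly_ring V)"
  proof (rule idealI[OF poly_ring_ring])
    show "subgroup J (add_monoid (poly_ring V))"
    proof (rule subgroup.intro)
      show "inv\<^bsub>add_monoid (poly_ring V)\<^esub> a \<in> J" if "a \<in> J" for a
        using that minus_poly_ring[of a V] sub diff_closedD(3)[OF d] by (auto simp: a_inv_def)
    qed (use sub diff_closedD[OF d] in \<open>auto simp: carrier_poly_ring poly_ring_ops\<close>)
    fix a p :: "('v, 'k) mpoly" assume "a \<in> J" "p \<in> carrier (poly_ring V)"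
    then have "p * a \<in> J" using J by (simp add: ideal_set_def carrier_poly_ring)
    then show "p \<otimes>\<^bsub>poly_ring V\<^esub> a \<in> J" "a \<otimes>\<^bsub>poly_ring V\<^esub> p \<in> J"
      by (simp_all add: poly_ring_ops mult.commute)
  qed
next
  assume "ideal J (poly_ring V)"
  then interpret J: ideal J "poly_ring V" .
  have sub: "J \<subseteq> polys_in V" using J.Icarr by (auto simp: carrier_poly_ring)
  have "a - b \<in> J" if "a \<in> J" "b \<in> J" for a b
  proof -
    have "- 1 \<in> carrier (poly_ring V :: ('v, 'k) mpoly ring)"
      by (simp add: carrier_poly_ring polys_in_def)
    from additive_subgroup.a_closed[OF J.is_additive_subgroup that(1) J.I_l_closed[OF that(2) this]] show ?thesis
      by (simp add: poly_ring_ops)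
  qed
  moreover have "0 \<in> J" using additive_subgroup.zero_closed[OF J.is_additive_subgroup] by (simp add: poly_ring_ops)
  ultimately show "ideal_set (polys_in V) J"
    using J.I_l_closed sub by (auto simp: ideal_set_def diff_closed_def carrier_poly_ring poly_ring_ops)
qed

lemma
  fixes S :: "('v, 'k::field) mpoly set"
  assumes "S \<subseteq> polys_in V"
  shows ideal_set_genideal: "ideal_set (polys_in V) (genideal (poly_ring V) S)"
    and genideal_superset: "S \<subseteq> genideal (poly_ring V) S"
    and genideal_least: "ideal_set (polys_in V) J \<Longrightarrow> S \<subseteq> J \<Longrightarrow> genideal (poly_ring V) S \<subseteq> J"
proof -
  interpret R: ring "poly_ring V :: ('v, 'k) mpoly ring" by (rule poly_ring_ring)
  show "ideal_set (polys_in V) (genideal (poly_ring V) S)"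
    using R.genideal_ideal[of S] assms by (simp add: ideal_poly_ring_iff carrier_poly_ring)
  show "S \<subseteq> genideal (poly_ring V) S"
    using R.genideal_self[of S] assms by (simp add: carrier_poly_ring)
  show "ideal_set (polys_in V) J \<Longrightarrow> S \<subseteq> J \<Longrightarrow> genideal (poly_ring V) S \<subseteq> J"
    using R.genideal_minimal[of J S] by (simp add: ideal_poly_ring_iff)
qed

text \<open>A monomial lies in the ideal exactly when some matching covers only vertices of its support.\<close>

lemma squarefree_power_eq_nonface_ideal:
  assumes V: "\<Union>E \<subseteq> V" and fin: "\<And>e. e \<in> E \<Longrightarrow> finite e"
  shows "squarefree_power V E q
    = (nonface_ideal V {F. \<nexists>M. q_matching E q M \<and> \<Union>M \<subseteq> F} :: ('v, 'k::field) mpoly set)"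
    (is "_ = nonface_ideal V ?\<Delta>")
proof -
  let ?B = "polys_in V :: ('v, 'k) mpoly set" and ?N = "nonface_ideal V ?\<Delta> :: ('v, 'k) mpoly set"
  let ?G = "{\<Prod>u\<in>\<Union>M. poly_var u | M. q_matching E q M} :: ('v, 'k) mpoly set"
  have down: "down_closed ?\<Delta>" by (auto simp: down_closed_def)
  have M: "finite (\<Union>M)" "\<Union>M \<subseteq> V" if "q_matching E q M" for M
    using that V fin unfolding q_matching_def by (blast intro: finite_Union)+
  have gen: "(\<Prod>u\<in>\<Union>M. poly_var u) \<in> ?N" if M': "q_matching E q M" for M
    using M[OF M'] M'
    by (auto simp: prod_poly_var nonface_ideal_def polys_in_def keys_squarefree_exponent)
  then have GN: "?G \<subseteq> ?N" by auto
  then have GB: "?G \<subseteq> ?B" by (auto simp: nonface_ideal_def)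
  note I = ideal_set_genideal[OF GB]
  have "p \<in> genideal (poly_ring V) ?G" if p: "p \<in> ?N" for p
  proof -
    have "Poly_Mapping.single m (Poly_Mapping.lookup p m) \<in> genideal (poly_ring V) ?G"
      if m: "m \<in> Poly_Mapping.keys p" for m
    proof -
      obtain M where M': "q_matching E q M" "\<Union>M \<subseteq> Poly_Mapping.keys m"
        using p m by (auto simp: nonface_ideal_def)
      let ?e = "squarefree_exponent (\<Union>M)"
      \<comment> \<open>Subtraction of exponents truncates; the equation holds because \<open>m\<close> is positive on \<open>\<Union>M\<close>.\<close>
      have "m = (m - ?e) + ?e"
      proof (rule poly_mapping_eqI)
        fix u
        have "Poly_Mapping.lookup ?e u = (if u \<in> \<Union>M then 1 else 0)"
          using M(1)[OF M'(1)] by (simp add: squarefree_exponent_def lookup_sum lookup_single when_def)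
        moreover have "Poly_Mapping.lookup m u \<ge> 1" if "u \<in> \<Union>M"
          using M'(2) that by (auto simp: in_keys_iff Suc_le_eq)
        ultimately show "Poly_Mapping.lookup m u = Poly_Mapping.lookup ((m - ?e) + ?e) u"
          by (auto simp: lookup_add lookup_minus)
      qed
      then have "Poly_Mapping.single m (Poly_Mapping.lookup p m)
          = Poly_Mapping.single (m - ?e) (Poly_Mapping.lookup p m) * (\<Prod>u\<in>\<Union>M. poly_var u)"
        using M(1)[OF M'(1)] by (simp add: prod_poly_var mult_single)
      moreover have "Poly_Mapping.keys (m - ?e) \<subseteq> Poly_Mapping.keys m"
        by (auto simp: in_keys_iff lookup_minus)
      then have "Poly_Mapping.single (m - ?e) (Poly_Mapping.lookup p m) \<in> ?B"
        using p m by (auto simp: nonface_ideal_def polys_in_def)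
      moreover have "(\<Prod>u\<in>\<Union>M. poly_var u) \<in> genideal (poly_ring V) ?G"
        using genideal_superset[OF GB] M'(1) by blast
      ultimately show ?thesis using I by (simp add: ideal_set_def)
    qed
    then show ?thesis
      using I by (subst sum_monomials[of p]) (auto intro!: diff_closed_sum simp: ideal_set_def)
  qed
  then show ?thesis
    unfolding squarefree_power_def
    using genideal_least[OF GB ideal_set_nonface_ideal[OF down] GN] by blast
qed

text \<open>The lift to the ring of the submodule \<open>seq_submodule\<close> of the quotient by \<open>N\<close>.\<close>

primrec ideal_span :: "'a::comm_ring_1 set \<Rightarrow> 'a set \<Rightarrow> 'a list \<Rightarrow> 'a set" where
  "ideal_span B N [] = N"
| "ideal_span B N (f # fs) = {f * x + y | x y. x \<in> B \<and> y \<in> ideal_span B N fs}"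

lemma ideal_span_enlarge: "ideal_span B N (f # fs) = ideal_span B (enlarge N f B) fs"
proof (induction fs)
  case Nil
  show ?case by (auto simp: enlarge_def) (metis add.commute)+
next
  case (Cons g fs)
  have "ideal_span B N (f # g # fs) = {g * y + z | y z. y \<in> B \<and> z \<in> ideal_span B N (f # fs)}"
    by (auto; metis add.left_commute)
  then show ?case unfolding Cons.IH by simp
qed

lemma regular_mod_iff_ideal_span:
  "regular_mod B N fs \<longleftrightarrow>
     (\<forall>i<length fs. \<forall>b\<in>B. fs ! i * b \<in> ideal_span B N (take i fs) \<longrightarrow> b \<in> ideal_span B N (take i fs))"
proof (induction fs arbitrary: N)
  case Nil
  then show ?case by simp
next
  case (Cons f fs)
  show ?case
    unfolding regular_mod.simps Cons.IH length_Cons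
    by (simp add: All_less_Suc2 ideal_span_enlarge del: ideal_span.simps(2))
qed

lemma zero_mem_polys_in [simp]: "0 \<in> polys_in V"
  by (simp add: polys_in_def)

lemma ideal_set_ideal_span:
  assumes "ideal_set (polys_in V) N" "set fs \<subseteq> polys_in V"
  shows "ideal_set (polys_in V) (ideal_span (polys_in V) N fs)"
  using assms
proof (induction fs arbitrary: N)
  case (Cons f fs)
  then show ?case
    unfolding ideal_span_enlarge by (intro Cons.IH ideal_set_enlarge subring_set_polys_in) auto
qed simp

lemma subset_ideal_span: "0 \<in> B \<Longrightarrow> N \<subseteq> ideal_span B N fs"
proof (induction fs)
  case (Cons f fs)
  show ?case
  proof
    fix n assume "n \<in> N"
    then have "n = f * 0 + n" "0 \<in> B" "n \<in> ideal_span B N fs" using Cons by auto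
    then show "n \<in> ideal_span B N (f # fs)" by (simp only: ideal_span.simps) blast
  qed
qed simp

lemma carrier_quot_module: "carrier (quot_module R I) = {I +>\<^bsub>R\<^esub> x | x. x \<in> carrier R}"
  by (auto simp: quot_module_def FactRing_simps)

context
  fixes V :: "'v set" and N :: "('v, 'k::field) mpoly set"
  assumes N: "ideal_set (polys_in V) N"
begin

private abbreviation (input) "R \<equiv> poly_ring V :: ('v, 'k) mpoly ring"
private abbreviation (input) "M \<equiv> quot_module R N"

lemma coset_eq_iff:
  assumes "a \<in> polys_in V" "b \<in> polys_in V"
  shows "N +>\<^bsub>R\<^esub> a = N +>\<^bsub>R\<^esub> b \<longleftrightarrow> a - b \<in> N"
proof -
  interpret R: ring R by (rule poly_ring_ring)
  have "ideal N R" using N by (simp add: ideal_poly_ring_iff)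
  then have "a \<ominus>\<^bsub>R\<^esub> b \<in> N \<longleftrightarrow> N +>\<^bsub>R\<^esub> a = N +>\<^bsub>R\<^esub> b"
    using assms by (intro R.quotient_eq_iff_same_a_r_cos) (simp_all add: carrier_poly_ring)
  moreover have "a \<ominus>\<^bsub>R\<^esub> b = a - b"
    using minus_poly_ring[OF assms(2)] by (simp add: a_minus_def poly_ring_ops)
  ultimately show ?thesis by simp
qed

lemma quot_module_carrier: "carrier M = {N +>\<^bsub>R\<^esub> a | a. a \<in> polys_in V}"
  by (simp add: carrier_quot_module carrier_poly_ring)

lemma quot_module_smult:
  assumes "f \<in> polys_in V" "a \<in> polys_in V"
  shows "f \<odot>\<^bsub>M\<^esub> (N +>\<^bsub>R\<^esub> a) = N +>\<^bsub>R\<^esub> (f * a)"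
proof -
  interpret ideal N R using N by (simp add: ideal_poly_ring_iff)
  show ?thesis
    using assms rcoset_mult_add[of f a] by (simp add: quot_module_def carrier_poly_ring poly_ring_ops)
qed

lemma quot_module_add:
  assumes "a \<in> polys_in V" "b \<in> polys_in V"
  shows "(N +>\<^bsub>R\<^esub> a) \<oplus>\<^bsub>M\<^esub> (N +>\<^bsub>R\<^esub> b) = N +>\<^bsub>R\<^esub> (a + b)"
proof -
  interpret ideal N R using N by (simp add: ideal_poly_ring_iff)
  show ?thesis
    using assms a_rcos_sum[of a b]
    by (simp add: quot_module_def FactRing_def carrier_poly_ring poly_ring_ops)
qed

lemma quot_module_zero: "\<zero>\<^bsub>M\<^esub> = N +>\<^bsub>R\<^esub> 0"
proof -
  interpret ideal N R using N by (simp add: ideal_poly_ring_iff)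
  show ?thesis
    using a_coset_add_zero[OF a_subset] by (simp add: quot_module_def FactRing_def poly_ring_ops)
qed

lemma seq_submodule_quot_module:
  assumes "set fs \<subseteq> polys_in V"
  shows "seq_submodule M fs = {N +>\<^bsub>R\<^esub> a | a. a \<in> ideal_span (polys_in V) N fs}"
  using assms
proof (induction fs)
  case Nil
  have "N +>\<^bsub>R\<^esub> a = N +>\<^bsub>R\<^esub> 0" if "a \<in> N" for a
    using that N by (subst coset_eq_iff) (auto simp: ideal_set_def)
  moreover have "0 \<in> N" using N diff_closedD(1)[of N] by (simp add: ideal_set_def)
  ultimately show ?case unfolding seq_submodule.simps ideal_span.simps quot_module_zero by blast
next
  case (Cons f fs)
  let ?B = "polys_in V :: ('v, 'k) mpoly set"
  have f: "f \<in> ?B" and fs: "set fs \<subseteq> ?B" using Cons.prems by auto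
  have sub: "ideal_span ?B N fs \<subseteq> ?B"
    using ideal_set_ideal_span[OF N fs] by (simp add: ideal_set_def)
  have mult: "f * x \<in> ?B" if "x \<in> ?B" for x
    using subring_set_polys_in[of V] f that by (auto simp: subring_set_def)
  have step: "f \<odot>\<^bsub>M\<^esub> (N +>\<^bsub>R\<^esub> x) \<oplus>\<^bsub>M\<^esub> (N +>\<^bsub>R\<^esub> y) = N +>\<^bsub>R\<^esub> (f * x + y)"
    if "x \<in> ?B" "y \<in> ideal_span ?B N fs" for x y
    using that sub mult f by (auto simp: quot_module_smult quot_module_add)
  have "X \<in> seq_submodule M (f # fs) \<longleftrightarrow>
      (\<exists>x\<in>?B. \<exists>y\<in>ideal_span ?B N fs. X = f \<odot>\<^bsub>M\<^esub> (N +>\<^bsub>R\<^esub> x) \<oplus>\<^bsub>M\<^esub> (N +>\<^bsub>R\<^esub> y))" for X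
    unfolding seq_submodule.simps Cons.IH[OF fs] quot_module_carrier by blast
  then have "X \<in> seq_submodule M (f # fs) \<longleftrightarrow>
      (\<exists>x\<in>?B. \<exists>y\<in>ideal_span ?B N fs. X = N +>\<^bsub>R\<^esub> (f * x + y))" for X
    using step by simp
  then show ?case by auto
qed

lemma coset_mem_seq_submodule_iff:
  assumes fs: "set fs \<subseteq> polys_in V" and a: "a \<in> polys_in V"
  shows "N +>\<^bsub>R\<^esub> a \<in> seq_submodule M fs \<longleftrightarrow> a \<in> ideal_span (polys_in V) N fs" (is "_ \<longleftrightarrow> a \<in> ?S")
proof -
  have S: "diff_closed ?S" "?S \<subseteq> polys_in V"
    using ideal_set_ideal_span[OF N fs] by (auto simp: ideal_set_def)
  have NS: "N \<subseteq> ?S" by (rule subset_ideal_span) simp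
  have "a \<in> ?S" if "N +>\<^bsub>R\<^esub> a = N +>\<^bsub>R\<^esub> b" "b \<in> ?S" for b
  proof -
    have "a - b \<in> ?S" using that coset_eq_iff[OF a, of b] S NS by auto
    then show ?thesis using diff_closed_sub_iff[OF S(1)] that(2) by blast
  qed
  then show ?thesis unfolding seq_submodule_quot_module[OF fs] by auto
qed

text \<open>Translation from cosets to representatives; a submodule generated by a sequence is proper
  exactly when its lift omits \<open>1\<close>.\<close>

lemma regular_sequence_quot_module_iff:
  "regular_sequence R M fs \<longleftrightarrow> set fs \<subseteq> polys_in V \<and> regular_mod (polys_in V) N fs \<and>
     1 \<notin> ideal_span (polys_in V) N fs"
proof (cases "set fs \<subseteq> polys_in V")
  case True
  let ?B = "polys_in V :: ('v, 'k) mpoly set"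
  have B: "subring_set ?B" by (rule subring_set_polys_in)
  have mem: "(fs ! i) \<odot>\<^bsub>M\<^esub> (N +>\<^bsub>R\<^esub> b) \<in> seq_submodule M (take i fs)
      \<longleftrightarrow> fs ! i * b \<in> ideal_span ?B N (take i fs)"
    "N +>\<^bsub>R\<^esub> b \<in> seq_submodule M (take i fs) \<longleftrightarrow> b \<in> ideal_span ?B N (take i fs)"
    if "i < length fs" "b \<in> ?B" for i b
  proof -
    have t: "set (take i fs) \<subseteq> ?B" and f: "fs ! i \<in> ?B"
      using True that(1) by (auto dest: in_set_takeD)
    have "fs ! i * b \<in> ?B" using B f that(2) by (simp add: subring_set_def)
    then show "(fs ! i) \<odot>\<^bsub>M\<^esub> (N +>\<^bsub>R\<^esub> b) \<in> seq_submodule M (take i fs)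
      \<longleftrightarrow> fs ! i * b \<in> ideal_span ?B N (take i fs)"
      using quot_module_smult[OF f that(2)] coset_mem_seq_submodule_iff[OF t] by simp
    show "N +>\<^bsub>R\<^esub> b \<in> seq_submodule M (take i fs) \<longleftrightarrow> b \<in> ideal_span ?B N (take i fs)"
      by (rule coset_mem_seq_submodule_iff[OF t that(2)])
  qed
  have "(\<forall>i<length fs. \<forall>x\<in>carrier M. (fs ! i) \<odot>\<^bsub>M\<^esub> x \<in> seq_submodule M (take i fs)
          \<longrightarrow> x \<in> seq_submodule M (take i fs)) \<longleftrightarrow> regular_mod ?B N fs"
  proof -
    have "(\<forall>x\<in>carrier M. P x) \<longleftrightarrow> (\<forall>b\<in>?B. P (N +>\<^bsub>R\<^esub> b))" for P
      unfolding quot_module_carrier by blast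
    then show ?thesis unfolding regular_mod_iff_ideal_span by (simp add: mem)
  qed
  moreover have "seq_submodule M fs = carrier M \<longleftrightarrow> 1 \<in> ideal_span ?B N fs"
  proof
    have "1 \<in> ?B" using B by (simp add: subring_set_def)
    then show "1 \<in> ideal_span ?B N fs" if "seq_submodule M fs = carrier M"
      unfolding coset_mem_seq_submodule_iff[OF True \<open>1 \<in> ?B\<close>, symmetric] that quot_module_carrier by blast
    assume one: "1 \<in> ideal_span ?B N fs"
    have "ideal_span ?B N fs = ?B"
    proof
      show "ideal_span ?B N fs \<subseteq> ?B"
        using ideal_set_ideal_span[OF N True] by (simp add: ideal_set_def)
      show "?B \<subseteq> ideal_span ?B N fs"
      proof
        fix b assume "b \<in> ?B"
        then have "b * 1 \<in> ideal_span ?B N fs"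
          using ideal_set_ideal_span[OF N True] one unfolding ideal_set_def by blast
        then show "b \<in> ideal_span ?B N fs" by simp
      qed
    qed
    then show "seq_submodule M fs = carrier M"
      unfolding seq_submodule_quot_module[OF True] quot_module_carrier by simp
  qed
  ultimately show ?thesis
    using True by (simp add: regular_sequence_def carrier_poly_ring)
qed (simp add: regular_sequence_def carrier_poly_ring)

end

section \<open>Depth of quotients by nonface ideals\<close>

lemma homogeneous_maximal_ideal_combination:
  fixes v :: "'i \<Rightarrow> 'v"
  assumes K: "finite K" and f: "f \<in> (homogeneous_maximal_ideal (v ` K) :: ('v, 'k::field) mpoly set)"
  shows "\<exists>g. (\<forall>k. g k \<in> polys_in (v ` K)) \<and> f = (\<Sum>k\<in>K. g k * poly_var (v k))"
proof -
  let ?B = "polys_in (v ` K) :: ('v, 'k) mpoly set"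
  let ?x = "\<lambda>k. poly_var (v k) :: ('v, 'k) mpoly"
  let ?J = "{\<Sum>k\<in>K. g k * ?x k | g. \<forall>k. g k \<in> ?B}"
  have B: "subring_set ?B" by (rule subring_set_polys_in)
  then have dB: "diff_closed ?B" and one: "1 \<in> ?B" and mult: "\<And>a b. a \<in> ?B \<Longrightarrow> b \<in> ?B \<Longrightarrow> a * b \<in> ?B"
    by (auto simp: subring_set_def)
  have x: "?x k \<in> ?B" if "k \<in> K" for k using that by (simp add: poly_var_mem)
  have "ideal_set ?B ?J"
    unfolding ideal_set_def diff_closed_def
  proof (intro conjI ballI)
    show "0 \<in> ?J" using diff_closedD(1)[OF dB] by (intro CollectI exI[of _ "\<lambda>_. 0"]) simp
    show "?J \<subseteq> ?B" using x mult by (auto intro!: diff_closed_sum[OF dB])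
    fix a b assume "b \<in> ?J"
    then obtain h where h: "b = (\<Sum>k\<in>K. h k * ?x k)" "\<forall>k. h k \<in> ?B" by blast
    { assume "a \<in> ?J"
      then obtain g where g: "a = (\<Sum>k\<in>K. g k * ?x k)" "\<forall>k. g k \<in> ?B" by blast
      then show "a - b \<in> ?J"
        using h diff_closedD(2)[OF dB]
        by (intro CollectI exI[of _ "\<lambda>k. g k - h k"]) (simp add: left_diff_distrib sum_subtractf) }
    { assume "a \<in> ?B"
      then show "a * b \<in> ?J"
        using h mult by (intro CollectI exI[of _ "\<lambda>k. a * h k"]) (simp add: sum_distrib_left mult.assoc) }
  qed
  moreover have "poly_var ` v ` K \<subseteq> ?J"
  proof (clarify)
    fix k assume k: "k \<in> K"
    have "?x k = (\<Sum>l\<in>K. (if l = k then 1 else 0) * ?x l)"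
      using K k by (simp add: if_distrib[of "\<lambda>c. c * _"] cong: if_cong)
    then show "\<exists>g. ?x k = (\<Sum>l\<in>K. g l * ?x l) \<and> (\<forall>l. g l \<in> ?B)"
      using one diff_closedD(1)[OF dB] by (intro exI[of _ "\<lambda>l. if l = k then 1 else 0"]) auto
  qed
  moreover have "poly_var ` v ` K \<subseteq> ?B" using x by auto
  ultimately have "homogeneous_maximal_ideal (v ` K) \<subseteq> ?J"
    unfolding homogeneous_maximal_ideal_def by (intro genideal_least)
  then show ?thesis using f by blast
qed

lemma poly_var_image_subset: "poly_var ` V \<subseteq> polys_in V"
  by (auto simp: poly_var_mem)

lemma complete_homogeneous_mem_maximal_ideal:
  "(complete_homogeneous xs (Suc i) :: ('v, 'k::field) mpoly) \<in> homogeneous_maximal_ideal (set xs)"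
proof -
  have "(complete_homogeneous xs (Suc i) :: ('v, 'k::field) mpoly) \<in> homogeneous_maximal_ideal V"
    if "set xs \<subseteq> V" for V xs i
    using that
  proof (induction xs "Suc i" arbitrary: i rule: complete_homogeneous.induct)
    case (2 i)
    have "ideal_set (polys_in V) (homogeneous_maximal_ideal V :: ('v, 'k) mpoly set)"
      unfolding homogeneous_maximal_ideal_def by (rule ideal_set_genideal[OF poly_var_image_subset])
    then show ?case using diff_closedD(1) by (auto simp: ideal_set_def)
  next
    case (3 x xs i)
    let ?J = "homogeneous_maximal_ideal V :: ('v, 'k) mpoly set"
    have J: "ideal_set (polys_in V) ?J"
      unfolding homogeneous_maximal_ideal_def by (rule ideal_set_genideal[OF poly_var_image_subset])
    have "poly_var x \<in> ?J"
      using genideal_superset[OF poly_var_image_subset[of V]] 3(3)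
      by (auto simp: homogeneous_maximal_ideal_def)
    moreover have "complete_homogeneous (x # xs) i \<in> (polys_in V :: ('v, 'k) mpoly set)"
      using complete_homogeneous_mem[of "x # xs" i, where ?'k = 'k] 3(3) by (auto simp: polys_in_def)
    ultimately have "complete_homogeneous (x # xs) i * poly_var x \<in> ?J"
      using J by (simp add: ideal_set_def)
    moreover have "complete_homogeneous xs (Suc i) \<in> ?J" using 3 by auto
    ultimately show ?case
      using diff_closedD(4)[of ?J] J by (simp add: ideal_set_def mult.commute)
  qed
  then show ?thesis by blast
qed

text \<open>The complete homogeneous polynomials of degrees \<open>1, \<dots>, d\<close> realise the bound. The degrees are
  positive, so the polynomials lie in the maximal ideal and generate a proper submodule.\<close>

lemma depth_nonface_ideal_ge:
  fixes \<Delta> :: "'v set set"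
  assumes V: "finite V" and \<Delta>: "down_closed \<Delta>" and d: "d \<le> card V"
    and skel: "\<And>S. S \<subseteq> V \<Longrightarrow> card S \<le> d \<Longrightarrow> S \<in> \<Delta>"
  shows "enat d \<le> depth (poly_ring V) (homogeneous_maximal_ideal V)
    (quot_module (poly_ring V) (nonface_ideal V \<Delta> :: ('v, 'k::field) mpoly set))"
proof -
  obtain xs where xs: "set xs = V" "distinct xs" using finite_distinct_list[OF V] by blast
  let ?B = "polys_in V :: ('v, 'k) mpoly set" and ?N = "nonface_ideal V \<Delta> :: ('v, 'k) mpoly set"
  let ?m = "homogeneous_maximal_ideal V :: ('v, 'k) mpoly set"
  let ?fs = "map (complete_homogeneous xs) [1..<1 + d] :: ('v, 'k) mpoly list"
  \<comment> \<open>With the empty set as the only face, this is the ideal of polynomials without constant term.\<close>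
  let ?J = "nonface_ideal V {{}} :: ('v, 'k) mpoly set"
  have N: "ideal_set ?B ?N" by (rule ideal_set_nonface_ideal[OF \<Delta>])
  have J: "ideal_set ?B ?J" by (rule ideal_set_nonface_ideal) (simp add: down_closed_def)
  have m: "set ?fs \<subseteq> ?m"
  proof
    fix f assume "f \<in> set ?fs"
    then obtain i where "f = complete_homogeneous xs (Suc i)" by (auto simp: Suc_le_eq gr0_conv_Suc)
    then show "f \<in> ?m" using complete_homogeneous_mem_maximal_ideal[of xs i] xs(1) by simp
  qed
  have "Poly_Mapping.single x (Suc 0) \<noteq> 0" for x :: 'v
    by (metis lookup_single_eq lookup_zero nat.distinct(1))
  then have "?m \<subseteq> ?J"
    unfolding homogeneous_maximal_ideal_def
    by (intro genideal_least[OF poly_var_image_subset J])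
      (auto simp: nonface_ideal_def polys_in_def poly_var_def)
  then have fJ: "set ?fs \<subseteq> ?J" using m by blast
  then have fB: "set ?fs \<subseteq> ?B" by (auto simp: nonface_ideal_def)
  have "1 \<notin> ?J" by (simp add: nonface_ideal_def)
  have "ideal_span ?B ?N fs \<subseteq> ?J" if "set fs \<subseteq> ?J" for fs
    using that
  proof (induction fs)
    case Nil
    show ?case using skel[of "{}"] by (auto simp: nonface_ideal_def)
  next
    case (Cons f fs)
    have "f * x + y \<in> ?J" if "x \<in> ?B" "y \<in> ideal_span ?B ?N fs" for x y
    proof -
      have "x * f \<in> ?J" using J Cons.prems that(1) by (simp add: ideal_set_def)
      moreover have "y \<in> ?J" using Cons that(2) by auto
      ultimately show ?thesis
        using J diff_closedD(4)[of ?J "x * f" y] by (simp add: ideal_set_def mult.commute)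
    qed
    then show ?case by auto
  qed
  from this[OF fJ] have "1 \<notin> ideal_span ?B ?N ?fs"
    using \<open>1 \<notin> ?J\<close> by blast
  moreover have "regular_mod ?B ?N ?fs"
    using regular_mod_complete_homogeneous[OF xs(2) \<Delta>, of d 1] d skel xs distinct_card[OF xs(2)] by simp
  ultimately have "regular_sequence (poly_ring V) (quot_module (poly_ring V) ?N) ?fs"
    using fB by (simp add: regular_sequence_quot_module_iff[OF N] del: upt_Suc)
  then have "enat (length ?fs) \<le> depth (poly_ring V) ?m (quot_module (poly_ring V) ?N)"
    unfolding depth_def using m by (intro Sup_upper) blast
  then show ?thesis by (simp del: upt_Suc)
qed

lemma depth_nonface_ideal_le:
  fixes v :: "'i::linorder \<Rightarrow> 'v" and \<Delta> :: "'v set set"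
  assumes K: "finite K" and inj: "inj_on v K" and \<Delta>: "down_closed \<Delta>"
    and skel: "\<And>S. S \<subseteq> v ` K \<Longrightarrow> card S \<le> d \<Longrightarrow> S \<in> \<Delta>"
    and F: "F \<subseteq> K" "card F = d" and w: "w \<in> K - F"
    and facet: "\<And>k. k \<in> K - F \<Longrightarrow> insert (v k) (v ` F) \<notin> \<Delta>"
  shows "depth (poly_ring (v ` K)) (homogeneous_maximal_ideal (v ` K))
    (quot_module (poly_ring (v ` K)) (nonface_ideal (v ` K) \<Delta> :: ('v, 'k::field) mpoly set)) \<le> enat d"
  unfolding depth_def
proof (rule Sup_least, clarify)
  fix fs :: "('v, 'k) mpoly list"
  let ?B = "polys_in (v ` K) :: ('v, 'k) mpoly set" and ?N = "nonface_ideal (v ` K) \<Delta> :: ('v, 'k) mpoly set"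
  assume fs: "set fs \<subseteq> homogeneous_maximal_ideal (v ` K)"
    and reg: "regular_sequence (poly_ring (v ` K)) (quot_module (poly_ring (v ` K)) ?N) fs"
  have N: "ideal_set ?B ?N" by (rule ideal_set_nonface_ideal[OF \<Delta>])
  have "regular_mod ?B ?N fs" using reg by (simp add: regular_sequence_quot_module_iff[OF N])
  moreover have "\<exists>g. (\<forall>k. g k \<in> ?B) \<and> f = (\<Sum>k\<in>K. g k * poly_var (v k))" if "f \<in> set fs" for f
    using homogeneous_maximal_ideal_combination[OF K] fs that by blast
  ultimately have "koszul_exact K (\<lambda>k. poly_var (v k)) ?B ?N d" if "d < length fs"
    using that by (intro regular_mod_imp_koszul_exact[OF subring_set_polys_in N K]) (auto simp: poly_var_mem)
  then have "\<not> d < length fs"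
    using not_koszul_exact_facet[OF K inj \<Delta> skel F w facet, where ?'k = 'k] by blast
  then show "enat (length fs) \<le> enat d" by simp
qed

section \<open>The wheel\<close>

lemma card_Union_q_matching:
  assumes "q_matching E q M" and "\<And>e. e \<in> E \<Longrightarrow> card e = 2"
  shows "card (\<Union>M) = 2 * q"
proof -
  have fin: "finite e" if "e \<in> M" for e
  proof -
    have "card e = 2" using assms that by (auto simp: q_matching_def)
    then show ?thesis by (intro card_ge_0_finite) simp
  qed
  have "card (\<Union>M) = sum card M"
    using assms(1) fin by (intro card_Union_disjoint) (auto simp: q_matching_def)
  also have "\<dots> = (\<Sum>e\<in>M. 2)"
    using assms by (intro sum.cong) (auto simp: q_matching_def)
  also have "\<dots> = 2 * q" using assms(1) by (simp add: q_matching_def)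
  finally show ?thesis .
qed

lemma matching_number_le:
  assumes fin: "finite (\<Union>E)" and E: "\<And>e. e \<in> E \<Longrightarrow> card e = 2"
  shows "2 * matching_number E \<le> card (\<Union>E)"
proof -
  let ?Q = "{q. \<exists>M. q_matching E q M}"
  have bound: "2 * q \<le> card (\<Union>E)" if "q \<in> ?Q" for q
  proof -
    from that obtain M where M: "q_matching E q M" by blast
    then have "\<Union>M \<subseteq> \<Union>E" by (auto simp: q_matching_def)
    from card_mono[OF fin this] show ?thesis using card_Union_q_matching[OF M E] by simp
  qed
  have "?Q \<subseteq> {..card (\<Union>E)}" using bound by force
  then have "finite ?Q" by (rule finite_subset) simp
  moreover have "q_matching E 0 {}" by (simp add: q_matching_def)
  then have "?Q \<noteq> {}" by blast
  ultimately show ?thesis unfolding matching_number_def by (intro bound Max_in)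
qed

lemma card_wheel_edge:
  assumes "n \<ge> 3" "e \<in> wheel_edges n"
  shows "card e = 2"
  using assms by (auto simp: wheel_edges_def card_insert_if)

lemma Union_wheel_edges: "n \<ge> 3 \<Longrightarrow> \<Union>(wheel_edges n) \<subseteq> wheel_vertices n"
  by (auto simp: wheel_edges_def wheel_vertices_def)

text \<open>The hub has index zero, so that the facet used below consists of the vertices with index
  less than \<open>2 * q - 1\<close>.\<close>

definition wheel_vertex_of :: "nat \<Rightarrow> wheel_vertex" where
  "wheel_vertex_of k = (if k = 0 then Hub else Rim k)"

lemma wheel_vertices_eq_image: "wheel_vertices n = wheel_vertex_of ` {..n}"
proof -
  have "{..n} = insert 0 {1..n}" by auto
  then show ?thesis by (auto simp: wheel_vertices_def wheel_vertex_of_def image_iff)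
qed

lemma inj_wheel_vertex_of: "inj wheel_vertex_of"
  by (auto simp: inj_def wheel_vertex_of_def split: if_splits)

lemma card_wheel_vertices: "card (wheel_vertices n) = n + 1"
  unfolding wheel_vertices_eq_image using inj_wheel_vertex_of
  by (subst card_image) (auto intro: inj_on_subset)

text \<open>The hub and an initial path of \<open>2 * q - 2\<close> rim vertices form a facet: pairing the path vertices
  consecutively leaves the hub to be matched with whichever rim vertex \<open>k\<close> is added.\<close>

lemma wheel_q_matching:
  assumes "1 \<le> q" "2 * q - 1 \<le> k" "k \<le> n"
  shows "\<exists>M. q_matching (wheel_edges n) q M \<and>
    \<Union>M \<subseteq> insert (wheel_vertex_of k) (wheel_vertex_of ` {..<2 * q - 1})"
proof -
  let ?e = "\<lambda>i. {Rim (2 * i + 1), Rim (2 * i + 2)}"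
  let ?R = "?e ` {..<q - 1}"
  let ?M = "insert {Hub, Rim k} ?R"
  have k: "k \<ge> 1" using assms by simp
  have inj: "inj_on ?e {..<q - 1}"
    by (rule inj_onI) (auto simp: doubleton_eq_iff)
  have "{Hub, Rim k} \<notin> ?R" by auto
  then have "card ?M = q" using inj assms(1) by (simp add: card_image)
  moreover have "?M \<subseteq> wheel_edges n"
    using assms k by (auto simp: wheel_edges_def)
  moreover have "pairwise disjnt ?M"
  proof -
    have "disjnt (?e i) (?e j)" if "i \<noteq> j" for i j
    proof -
      have "2 * i \<noteq> Suc (2 * j)" "2 * j \<noteq> Suc (2 * i)" by presburger+
      then show ?thesis using that by (simp add: disjnt_def)
    qed
    then have "pairwise disjnt ?R" by (intro pairwise_imageI)
    moreover have "disjnt {Hub, Rim k} e" if "e \<in> ?R" for e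
      using that assms by (auto simp: disjnt_def)
    ultimately show ?thesis
      unfolding pairwise_insert using disjnt_sym[of "{Hub, Rim k}"] by simp
  qed
  ultimately have "q_matching (wheel_edges n) q ?M" unfolding q_matching_def by blast
  moreover have "\<Union>?M \<subseteq> insert (wheel_vertex_of k) (wheel_vertex_of ` {..<2 * q - 1})"
  proof -
    have v: "Hub = wheel_vertex_of 0" "Rim k = wheel_vertex_of k"
      "Rim (2 * i + 1) = wheel_vertex_of (2 * i + 1)" "Rim (2 * i + 2) = wheel_vertex_of (2 * i + 2)" for i
      using k by (simp_all add: wheel_vertex_of_def)
    have "?e i \<subseteq> wheel_vertex_of ` {..<2 * q - 1}" if "i < q - 1" for i
      unfolding v using that by (intro insert_subsetI imageI) auto
    moreover have "Hub \<in> wheel_vertex_of ` {..<2 * q - 1}"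
      unfolding v using assms(1) by (intro imageI) simp
    ultimately show ?thesis unfolding v(2) by blast
  qed
  ultimately show ?thesis by blast
qed

theorem theorem6p5:
  fixes n q :: nat
  assumes "n \<ge> 3"
    and "1 \<le> q" and "q \<le> matching_number (wheel_edges n)"
  shows "depth (poly_ring (wheel_vertices n) :: (wheel_vertex, 'k::field) mpoly ring)
           (homogeneous_maximal_ideal (wheel_vertices n))
           (quot_module (poly_ring (wheel_vertices n))
              (squarefree_power (wheel_vertices n) (wheel_edges n) q))
         = enat (2 * q - 1)"
proof -
  let ?V = "wheel_vertices n" and ?E = "wheel_edges n"
  let ?\<Delta> = "{F. \<nexists>M. q_matching ?E q M \<and> \<Union>M \<subseteq> F}"
  have fV: "finite ?V" by (simp add: wheel_vertices_def)
  have E: "card e = 2" if "e \<in> ?E" for e using card_wheel_edge[OF assms(1) that] .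
  have UE: "\<Union>?E \<subseteq> ?V" by (rule Union_wheel_edges[OF assms(1)])
  have "2 * matching_number ?E \<le> card (\<Union>?E)"
    using finite_subset[OF UE fV] E by (rule matching_number_le)
  also have "\<dots> \<le> n + 1" using card_mono[OF fV UE] by (simp add: card_wheel_vertices)
  finally have qn: "2 * q \<le> n + 1" using assms(3) by linarith
  have I: "squarefree_power ?V ?E q = (nonface_ideal ?V ?\<Delta> :: (wheel_vertex, 'k) mpoly set)"
    using UE E by (intro squarefree_power_eq_nonface_ideal) (auto intro!: card_ge_0_finite)
  have down: "down_closed ?\<Delta>" by (auto simp: down_closed_def)
  have skel: "S \<in> ?\<Delta>" if S: "S \<subseteq> ?V" "card S \<le> 2 * q - 1" for S
  proof clarify
    fix M assume M: "q_matching ?E q M" "\<Union>M \<subseteq> S"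
    have "2 * q \<le> card S"
      using card_mono[OF finite_subset[OF S(1) fV] M(2)] card_Union_q_matching[OF M(1) E] by simp
    then show False using S(2) assms(2) by linarith
  qed
  show ?thesis
    unfolding I
  proof (rule antisym)
    show "depth (poly_ring ?V) (homogeneous_maximal_ideal ?V)
        (quot_module (poly_ring ?V) (nonface_ideal ?V ?\<Delta> :: (wheel_vertex, 'k) mpoly set)) \<le> enat (2 * q - 1)"
      unfolding wheel_vertices_eq_image
    proof (rule depth_nonface_ideal_le)
      show "inj_on wheel_vertex_of {..n}" using inj_wheel_vertex_of by (rule inj_on_subset) simp
      show "{..<2 * q - 1} \<subseteq> {..n}" "2 * q - 1 \<in> {..n} - {..<2 * q - 1}" using qn assms(2) by auto
      show "S \<in> ?\<Delta>" if "S \<subseteq> wheel_vertex_of ` {..n}" "card S \<le> 2 * q - 1" for S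
        using that skel by (simp add: wheel_vertices_eq_image)
      show "insert (wheel_vertex_of k) (wheel_vertex_of ` {..<2 * q - 1}) \<notin> ?\<Delta>"
        if "k \<in> {..n} - {..<2 * q - 1}" for k
        using wheel_q_matching[OF assms(2), of k n] that by auto
    qed (use down in simp_all)
    show "enat (2 * q - 1) \<le> depth (poly_ring ?V) (homogeneous_maximal_ideal ?V)
        (quot_module (poly_ring ?V) (nonface_ideal ?V ?\<Delta> :: (wheel_vertex, 'k) mpoly set))"
      using qn skel by (intro depth_nonface_ideal_ge fV down) (simp_all add: card_wheel_vertices)
  qed
qed

end
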